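(* Let $\alpha, n$ be nonnegative integers and let $p_1,\dots,p_{\alpha+1}$ be primes (not necessarily distinct) such that $p_i\geq 5$ and $p_i\equiv 3 \pmod{4}$ for every $1\le i\le \alpha+1$. Then for any integer $j$ with $j \not\equiv 0 \pmod{p_{\alpha+1}}$, we have $$ b_{11}\left(p_1^2\cdots p_{\alpha+1}^2n+\frac{p_1^2\cdots p_{\alpha}^2p_{\alpha +1}(12j+5p_{\alpha +1})-5}{12}\right)\equiv 0 \pmod{11}.$$
   Context: For a positive integer $\ell$, an $\ell$-regular partition of a nonnegative integer $n$ is a partition of $n$ none of whose parts is divisible by $\ell$. The number of $\ell$-regular partitions of $n$ is denoted $b_\ell(n)$, with the conventions $b_\ell(0)=1$ and $b_\ell(n)=0$ for $n<0$. Its generating function is $\sum_{n=0}^\infty b_\ell(n)q^n=\prod_{i\ge 1}\frac{1-q^{\ell i}}{1-q^i}$. When $\alpha=0$, the empty product $p_1^2\cdots p_\alpha^2$ equals $1$. *)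

theory Defs
  imports "HOL-Library.Multiset" "HOL-Number_Theory.Cong" "HOL-Computational_Algebra.Primes"
begin

definition regular_partitions :: "nat \<Rightarrow> nat \<Rightarrow> nat multiset set" where
  "regular_partitions l n = {M. sum_mset M = n \<and> (\<forall>x\<in>#M. 0 < x \<and> \<not> l dvd x)}"

definition b_reg :: "nat \<Rightarrow> int \<Rightarrow> nat" where
  "b_reg l n = (if n < 0 then 0 else card (regular_partitions l (nat n)))"

(* Since card is 0 on infinite sets, the next lemma is what makes b_reg an honest count. *)
lemma finite_regular_partitions: "finite (regular_partitions l n)"
proof (rule finite_subset)
  show "regular_partitions l n \<subseteq> mset ` {xs. set xs \<subseteq> {..n} \<and> length xs \<le> n}"
  proof
    fix M assume M: "M \<in> regular_partitions l n"
    obtain xs where xs: "M = mset xs" by (metis ex_mset)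
    have s: "sum_list xs = n" and pos: "\<forall>x\<in>set xs. 0 < x"
      using M by (auto simp: regular_partitions_def xs sum_mset_sum_list)
    have "length ys \<le> sum_list ys" if "\<forall>y\<in>set ys. 0 < y" for ys :: "nat list"
      using that by (induction ys) auto
    with pos s have "length xs \<le> n" by blast
    moreover have "set xs \<subseteq> {..n}"
      using member_le_sum_list s by auto
    ultimately show "M \<in> mset ` {xs. set xs \<subseteq> {..n} \<and> length xs \<le> n}"
      using xs by blast
  qed
  show "finite (mset ` {xs. set xs \<subseteq> {..n} \<and> length xs \<le> n})"
    by (intro finite_imageI finite_lists_length_le) simp
qed

lemma b_reg_0: "b_reg l 0 = 1"
proof -
  have "regular_partitions l 0 = {{#}}"
    by (auto simp: regular_partitions_def sum_mset_0_iff intro: multiset_eqI)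
       (metis gr_implies_not0 multiset_nonemptyE)
  then show ?thesis by (simp add: b_reg_def)
qed

(* The quotient by 12 below is exact, so integer div is ordinary division there. *)
lemma argument_integral:
  fixes \<alpha> :: nat and p :: "nat \<Rightarrow> nat" and j :: int
  assumes "\<And>i. i \<in> {1..\<alpha>+1} \<Longrightarrow> prime (p i)"
    and "\<And>i. i \<in> {1..\<alpha>+1} \<Longrightarrow> p i \<ge> 5"
  shows "12 dvd (\<Prod>i=1..\<alpha>. int (p i) ^ 2) * int (p (\<alpha>+1)) * (12 * j + 5 * int (p (\<alpha>+1))) - 5"
proof -
  have sq: "[int q ^ 2 = 1] (mod 12)" if "prime q" "q \<ge> 5" for q :: nat
  proof -
    have "\<not> 2 dvd q" "\<not> 3 dvd q"
      using that by (auto dest: primes_dvd_imp_eq[rotated 2])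
    then have "q mod 12 = 1 \<or> q mod 12 = 5 \<or> q mod 12 = 7 \<or> q mod 12 = 11" by presburger
    then have "q ^ 2 mod 12 = 1"
      by (auto simp: power_mod[of q 12 2, symmetric])
    then have "int (q ^ 2 mod 12) = 1" by simp
    then show ?thesis by (simp add: cong_def zmod_int)
  qed
  let ?P = "\<Prod>i=1..\<alpha>. int (p i) ^ 2" and ?q = "int (p (\<alpha>+1))"
  have "[?P = (\<Prod>i=1..\<alpha>. 1)] (mod 12)"
    by (rule cong_prod) (use sq assms in auto)
  moreover have "[?q ^ 2 = 1] (mod 12)" using sq assms by auto
  ultimately have "[?P * ?q ^ 2 = 1] (mod 12)"
    using cong_mult by fastforce
  then have "12 dvd ?P * ?q ^ 2 - 1" by (simp add: cong_iff_dvd_diff)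
  then have "12 dvd 12 * (?P * ?q * j) + 5 * (?P * ?q ^ 2 - 1)"
    by (intro dvd_add dvd_mult dvd_triv_left)
  also have "12 * (?P * ?q * j) + 5 * (?P * ?q ^ 2 - 1) = ?P * ?q * (12 * j + 5 * ?q) - 5"
    by (simp add: algebra_simps power2_eq_square)
  finally show ?thesis .
qed

end

theory Submission
  imports Defs "HOL-Computational_Algebra.Formal_Laurent_Series" "HOL-Number_Theory.Residues"
begin

text \<open>
Write \<open>E_k\<close> for the product of all \<open>1 - q^(k i)\<close> with \<open>i \<ge> 1\<close>. The generating function of the
11-regular partitions is \<open>E_11 / E_1\<close>, and \<open>E_11\<close> is congruent to \<open>E_1^11\<close> modulo 11, so
\<open>b_11(M)\<close> is congruent to the coefficient of \<open>q^M\<close> in \<open>E_1^10\<close> (\<open>regular_fps_cong\<close>). The tenth power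
of the Euler product is lacunary: that coefficient is 0 unless \<open>24 M + 10\<close> is a sum of two squares
(\<open>euler_tenth_power_support\<close>). For the arguments \<open>M\<close> in question, \<open>24 M + 10\<close> is
\<open>2 (p_1 \<cdots> p_\<alpha>)^2 p c\<close> with \<open>p = p_(\<alpha>+1)\<close> and \<open>c\<close> prime to \<open>p\<close>. So \<open>p\<close>, a prime that is 3 modulo 4, divides
it to an odd power, and a sum of two squares does not allow that.

The lacunarity comes from the identity
\<open>E_1^10 = E_3^3 P + 3 (D(E_3^3) P - E_3^3 D P)\<close> with \<open>D = q d/dq\<close> and
\<open>P = \<Sum>(-1)^m (6 m + 1) q^(m (3 m + 1)/2)\<close>, the sum over all integers \<open>m\<close>
(\<open>euler_tenth_power\<close>). By Jacobi's formula, \<open>E_3^3\<close> only contains powers \<open>q^(3 n (n + 1)/2)\<close>, and \<open>D\<close>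
does not create new exponents. So an exponent \<open>M\<close> of the right-hand side is \<open>3 n (n + 1)/2 + m (3 m + 1)/2\<close>,
that is, \<open>24 M + 10 = (3 (2 n + 1))^2 + (6 m + 1)^2\<close>.

Two relations give the identity. Let \<open>S = \<Sum>\<sigma>(n) q^n\<close>.

  \<^item> \<open>P^2 = E_1^2 (1 + 12 S - 36 S(q^3))\<close>. The first two derivatives in \<open>z\<close>, at \<open>z = 1\<close>, of the triple
    product for \<open>\<Sum>(-1)^m z^m q^(m (3 m + 1)/2)\<close> express \<open>P\<close> and \<open>D E_1\<close> through the moments
    \<open>\<Sum>(-1)^m m^r q^(m (3 m + 1)/2)\<close>, and the second logarithmic derivative of the product is a
    Lambert series (\<open>pent_weighted_squared\<close>).

  \<^item> \<open>E_1^12 = E_3^3 P^3 - 27 q E_3^12\<close>. Jacobi's series for \<open>E_1^3\<close>, sorted by exponents modulo 3, is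
    \<open>P(q^3) - 3 q E_9^3\<close>. The product of its three conjugates under \<open>q \<mapsto> \<omega> q\<close>, where \<open>\<omega>\<close> is a primitive cube root of
    unity, is a difference of cubes (\<open>euler_cubic_relation\<close>).

Applying \<open>D\<close> to the second relation, with \<open>D E_1 = - E_1 S\<close> and \<open>D E_3 = - 3 E_3 S(q^3)\<close>, and eliminating
\<open>S\<close> by the first gives the identity multiplied by \<open>P^2\<close>.

All series are formal power series, and an infinite product is the coefficientwise limit of its
partial products. Limits commute with every operation used, so the product formulas follow from
identities between finite products and sums.
\<close>

unbundle fps_syntax

section \<open>Gaussian binomial coefficients and the finite triple product\<close>

text \<open>
Gaussian binomial coefficients. The lower index is an integer, with value 0 outside \<open>0..m\<close>, so that
shifting the index in a sum needs no boundary cases.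
\<close>
primrec qbinom :: "'a::comm_ring_1 \<Rightarrow> nat \<Rightarrow> int \<Rightarrow> 'a" where
  "qbinom Q 0 k = (if k = 0 then 1 else 0)"
| "qbinom Q (Suc m) k = qbinom Q m k + Q ^ nat (int m + 1 - k) * qbinom Q m (k - 1)"

lemma qbinom_eq_0: "k < 0 \<or> int m < k \<Longrightarrow> qbinom Q m k = 0"
  by (induction m arbitrary: k) auto

text \<open>
Each of the two factors of the triple product uses its own Pascal rule: the defining one matches the
factors \<open>1 + a Q^k\<close>, and this one the factors \<open>1 + b Q^k\<close>.
\<close>
lemma qbinom_Suc': "qbinom Q (Suc m) k = Q ^ nat k * qbinom Q m k + qbinom Q m (k - 1)"
proof (induction m arbitrary: k)
  case 0
  show ?case by auto
next
  case (Suc m)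
  (* The exponents agree only for 1 \<le> k \<le> m + 1, because nat truncates; otherwise the binomial is 0. *)
  have *: "Q ^ nat (int m + 2 - k) * Q ^ nat (k - 1) * qbinom Q m (k - 1) =
           Q ^ nat k * Q ^ nat (int m + 1 - k) * qbinom Q m (k - 1)"
  proof (cases "0 \<le> k - 1 \<and> k - 1 \<le> int m")
    case True
    then have "nat (int m + 2 - k) + nat (k - 1) = nat k + nat (int m + 1 - k)" by linarith
    then show ?thesis by (metis power_add)
  next
    case False
    then have "qbinom Q m (k - 1) = 0" by (intro qbinom_eq_0) auto
    then show ?thesis by simp
  qed
  have "qbinom Q (Suc (Suc m)) k =
     qbinom Q (Suc m) k + Q ^ nat (int m + 2 - k) * qbinom Q (Suc m) (k - 1)"
    by (simp add: add.commute)
  also have "\<dots> = Q ^ nat k * qbinom Q m k + qbinom Q m (k - 1)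
     + Q ^ nat (int m + 2 - k) * (Q ^ nat (k - 1) * qbinom Q m (k - 1) + qbinom Q m (k - 2))"
    by (simp only: Suc.IH diff_diff_eq one_add_one)
  also have "\<dots> = Q ^ nat k * (qbinom Q m k + Q ^ nat (int m + 1 - k) * qbinom Q m (k - 1))
     + (qbinom Q m (k - 1) + Q ^ nat (int m + 2 - k) * qbinom Q m (k - 2))"
    using * by (simp add: algebra_simps)
  also have "\<dots> = Q ^ nat k * qbinom Q (Suc m) k + qbinom Q (Suc m) (k - 1)"
    by (simp add: algebra_simps)
  finally show ?case .
qed

lemma qbinom_0_right: "qbinom Q m 0 = 1"
  by (induction m) (auto simp: qbinom_eq_0)

lemma qbinom_same: "qbinom Q m (int m) = 1"
  by (induction m) (auto simp: qbinom_eq_0)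

text \<open>
The formula for the Gaussian binomial as a quotient of products, with denominators cleared because
the ring need not have division. It determines the limit of the coefficients for large upper index.
\<close>
lemma qbinom_mult_prods:
  "qbinom Q (i + j) (int i) * (\<Prod>k=1..i. 1 - Q ^ k) * (\<Prod>k=1..j. 1 - Q ^ k)
     = (\<Prod>k=1..i+j. 1 - Q ^ k)"
proof (induction "i + j" arbitrary: i j)
  case 0
  then show ?case by simp
next
  case (Suc m)
  show ?case
  proof (cases "i = 0 \<or> j = 0")
    case True
    then show ?thesis by (auto simp: qbinom_0_right qbinom_same)
  next
    case False
    then obtain i' j' where ij: "i = Suc i'" "j = Suc j'" by (metis not0_implies_Suc)
    define p where "p n = (\<Prod>k=1..n. 1 - Q ^ k)" for n
    have p: "p (Suc n) = p n * (1 - Q ^ Suc n)" for n by (simp add: p_def)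
    have m: "m = i' + Suc j'" "m = Suc i' + j'" using Suc.hyps(2) ij by auto
    have 1: "qbinom Q m (int i') * p i' * p (Suc j') = p m"
      using Suc.hyps(1)[OF m(1)] m(1) by (simp add: p_def)
    have 2: "qbinom Q m (int (Suc i')) * p (Suc i') * p j' = p m"
      using Suc.hyps(1)[OF m(2)] m(2) by (simp only: p_def)
    have "nat (int m + 1 - int (Suc i')) = Suc j'" using m by simp
    then have "qbinom Q (Suc m) (int (Suc i'))
        = qbinom Q m (int (Suc i')) + Q ^ Suc j' * qbinom Q m (int i')"
      by (simp only: qbinom.simps) simp
    then have "qbinom Q (Suc m) (int (Suc i')) * p (Suc i') * p (Suc j')
       = (qbinom Q m (int (Suc i')) * p (Suc i') * p j') * (1 - Q ^ Suc j')
         + Q ^ (Suc j') * (1 - Q ^ Suc i') * (qbinom Q m (int i') * p i' * p (Suc j'))"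
      by (simp only: p algebra_simps)
    also have "\<dots> = p m * (1 - Q ^ (Suc i' + Suc j'))"
      by (simp only: 1 2) (simp add: algebra_simps power_add)
    also have "\<dots> = p (Suc m)" using m by (simp add: p)
    finally show ?thesis
      using Suc.hyps(2) ij by (simp only: p_def)
  qed
qed

text \<open>
The triangular number, also for negative arguments, where \<open>tri (- 1 - n) = tri n\<close>.
\<close>
definition tri :: "int \<Rightarrow> nat" where
  "tri n = nat (n * (n + 1) div 2)"

lemma int_tri: "int (tri n) * 2 = n * (n + 1)"
proof -
  have "0 \<le> n * (n + 1)"
    by (cases "0 \<le> n") (auto intro: mult_nonpos_nonpos)
  moreover have "even (n * (n + 1))" by auto
  ultimately show ?thesis by (auto simp: tri_def)
qed

lemma tri_succ: "int (tri (n + 1)) = int (tri n) + n + 1"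
proof -
  have "int (tri (n + 1)) * 2 = (int (tri n) + n + 1) * 2"
    using int_tri[of n] int_tri[of "n + 1"] by (simp add: algebra_simps)
  then show ?thesis by simp
qed

lemma tri_pred: "int (tri (n - 1)) = int (tri n) - n"
  using tri_succ[of "n - 1"] by simp

lemma abs_le_tri: "\<bar>n\<bar> \<le> int (tri n) + 1"
proof -
  consider "n \<ge> 2" | "n \<le> - 2" | "n = 0 \<or> n = 1 \<or> n = -1" by linarith
  then show ?thesis
  proof cases
    case 1
    then have "2 * (n + 1) \<le> n * (n + 1)" by (intro mult_right_mono) auto
    then have "n + 1 \<le> int (tri n)" using int_tri[of n] by simp
    then show ?thesis using 1 by simp
  next
    case 2
    then have "0 \<le> (- n - 2) * (- n - 1)" by (intro mult_nonneg_nonneg) auto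
    then show ?thesis using int_tri[of n] 2 by (simp add: algebra_simps)
  next
    case 3
    then show ?thesis using int_tri[of n] by auto
  qed
qed

text \<open>
In this symmetric form, with \<open>Q = a b\<close>, the monomial of index \<open>n\<close> has natural exponents for every integer
\<open>n\<close>, and no variable has to be invertible. Multiplying the monomial \<open>c n\<close> by \<open>a Q^M\<close> gives
\<open>Q^(M - n) c (n + 1)\<close>, so one more factor in \<open>a\<close> acts on the coefficients by a Pascal rule; the same holds
for \<open>b\<close> with \<open>n - 1\<close>.
\<close>
theorem finite_jacobi_triple_product:
  fixes a b Q :: "'a::comm_ring_1"
  assumes Q: "Q = a * b"
  shows "(\<Prod>k<M. 1 + a * Q ^ k) * (\<Prod>k<N. 1 + b * Q ^ k) =
     (\<Sum>n=-int N..int M. qbinom Q (M + N) (int N + n) * (a ^ tri n * b ^ tri (n - 1)))"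
proof -
  define c where "c n = a ^ tri n * b ^ tri (n - 1)" for n
  have c_a: "c n * (a * Q ^ M) = c (n + 1) * Q ^ nat (int M - n)" if "n \<le> int M" for n M
  proof -
    have "tri n + 1 + M = tri (n + 1) + nat (int M - n)"
      using that tri_succ[of n] by linarith
    moreover have "tri (n - 1) + M = tri n + nat (int M - n)"
      using that tri_pred[of n] by linarith
    moreover have "c n * (a * Q ^ M) = a ^ (tri n + 1 + M) * b ^ (tri (n - 1) + M)"
      by (simp add: c_def Q power_mult_distrib power_add algebra_simps)
    moreover have "c (n + 1) * Q ^ nat (int M - n)
        = a ^ (tri (n + 1) + nat (int M - n)) * b ^ (tri n + nat (int M - n))"
      by (simp add: c_def Q power_mult_distrib power_add algebra_simps)
    ultimately show ?thesis by simp
  qed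
  have c_b: "c n * (b * Q ^ N) = c (n - 1) * Q ^ nat (int N + n)" if "- int N \<le> n" for n N
  proof -
    have "tri n + N = tri (n - 1) + nat (int N + n)"
      using that tri_pred[of n] by linarith
    moreover have "tri (n - 1) + 1 + N = tri (n - 2) + nat (int N + n)"
      using that tri_pred[of "n - 1"] by simp
    moreover have "c n * (b * Q ^ N) = a ^ (tri n + N) * b ^ (tri (n - 1) + 1 + N)"
      by (simp add: c_def Q power_mult_distrib power_add algebra_simps)
    moreover have "c (n - 1) * Q ^ nat (int N + n)
        = a ^ (tri (n - 1) + nat (int N + n)) * b ^ (tri (n - 2) + nat (int N + n))"
      by (simp add: c_def Q power_mult_distrib power_add algebra_simps)
    ultimately show ?thesis by simp
  qed
  define S where "S M N = (\<Sum>n=-int N..int M. qbinom Q (M + N) (int N + n) * c n)" for M N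
  have Suc_M: "S M N * (1 + a * Q ^ M) = S (Suc M) N" for M N
  proof -
    let ?g = "\<lambda>n. qbinom Q (M + N) (int N + n)"
    have "S M N * (1 + a * Q ^ M)
       = (\<Sum>n=-int N..int M. ?g n * c n) + (\<Sum>n=-int N..int M. ?g n * (c n * (a * Q ^ M)))"
      by (simp add: S_def distrib_left sum_distrib_right mult.assoc)
    also have "(\<Sum>n=-int N..int M. ?g n * (c n * (a * Q ^ M)))
       = (\<Sum>n=-int N..int M. ?g n * (c (n + 1) * Q ^ nat (int M - n)))"
      by (intro sum.cong refl) (simp add: c_a)
    also have "\<dots> = (\<Sum>n=-int N+1..int M+1. ?g (n - 1) * (c n * Q ^ nat (int M + 1 - n)))"
      by (rule sum.reindex_bij_witness[of _ "\<lambda>n. n - 1" "\<lambda>n. n + 1"]) (auto simp: algebra_simps)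
    also have "\<dots> = (\<Sum>n=-int N..int M+1. ?g (n - 1) * (c n * Q ^ nat (int M + 1 - n)))"
      by (rule sum.mono_neutral_left) (auto simp: qbinom_eq_0)
    also have "(\<Sum>n=-int N..int M. ?g n * c n) = (\<Sum>n=-int N..int M+1. ?g n * c n)"
      by (rule sum.mono_neutral_left) (auto simp: qbinom_eq_0)
    also have "(\<Sum>n=-int N..int M+1. ?g n * c n)
        + (\<Sum>n=-int N..int M+1. ?g (n - 1) * (c n * Q ^ nat (int M + 1 - n))) = S (Suc M) N"
      unfolding S_def sum.distrib[symmetric]
      by (intro sum.cong) (auto simp: algebra_simps)
    finally show ?thesis .
  qed
  have Suc_N: "S M N * (1 + b * Q ^ N) = S M (Suc N)" for M N
  proof -
    let ?g = "\<lambda>n. qbinom Q (M + N) (int N + n)"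
    have "S M N * (1 + b * Q ^ N)
       = (\<Sum>n=-int N..int M. ?g n * c n) + (\<Sum>n=-int N..int M. ?g n * (c n * (b * Q ^ N)))"
      by (simp add: S_def distrib_left sum_distrib_right mult.assoc)
    also have "(\<Sum>n=-int N..int M. ?g n * (c n * (b * Q ^ N)))
       = (\<Sum>n=-int N..int M. ?g n * (c (n - 1) * Q ^ nat (int N + n)))"
      by (intro sum.cong refl) (simp add: c_b)
    also have "\<dots> = (\<Sum>n=-int N-1..int M-1. ?g (n + 1) * (c n * Q ^ nat (int N + 1 + n)))"
      by (rule sum.reindex_bij_witness[of _ "\<lambda>n. n + 1" "\<lambda>n. n - 1"]) (auto simp: algebra_simps)
    also have "\<dots> = (\<Sum>n=-int N-1..int M. ?g (n + 1) * (c n * Q ^ nat (int N + 1 + n)))"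
      by (rule sum.mono_neutral_left) (auto simp: qbinom_eq_0)
    also have "(\<Sum>n=-int N..int M. ?g n * c n) = (\<Sum>n=-int N-1..int M. ?g n * c n)"
      by (rule sum.mono_neutral_left) (auto simp: qbinom_eq_0)
    also have "(\<Sum>n=-int N-1..int M. ?g n * c n)
        + (\<Sum>n=-int N-1..int M. ?g (n + 1) * (c n * Q ^ nat (int N + 1 + n))) = S M (Suc N)"
      unfolding S_def sum.distrib[symmetric]
      by (intro sum.cong) (auto simp: algebra_simps qbinom_Suc' simp del: qbinom.simps)
    finally show ?thesis .
  qed
  have "S 0 0 = 1" by (simp add: S_def c_def tri_def)
  then have "(\<Prod>k<N. 1 + b * Q ^ k) = S 0 N" by (induction N) (auto simp: Suc_N)
  then have "(\<Prod>k<M. 1 + a * Q ^ k) * (\<Prod>k<N. 1 + b * Q ^ k) = S M N"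
    by (induction M) (auto simp: Suc_M[symmetric] algebra_simps)
  then show ?thesis by (simp add: S_def c_def)
qed

section \<open>Euler products and theta series as formal limits\<close>

lemma tendsto_mult_fps:
  fixes f g :: "_ \<Rightarrow> 'a::ring fps"
  assumes "(f \<longlongrightarrow> a) F" "(g \<longlongrightarrow> b) F"
  shows "((\<lambda>x. f x * g x) \<longlongrightarrow> a * b) F"
proof (rule tendsto_fpsI)
  fix n
  have "eventually (\<lambda>x. \<forall>i\<in>{..n}. f x $ i = a $ i) F"
    "eventually (\<lambda>x. \<forall>i\<in>{..n}. g x $ i = b $ i) F"
    using assms by (auto simp: eventually_ball_finite_distrib tendsto_fps_iff)
  then show "eventually (\<lambda>x. (f x * g x) $ n = (a * b) $ n) F"
    by eventually_elim (auto simp: fps_mult_nth)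
qed

lemma tendsto_diff_fps:
  fixes f g :: "_ \<Rightarrow> 'a::ab_group_add fps"
  assumes "(f \<longlongrightarrow> a) F" "(g \<longlongrightarrow> b) F"
  shows "((\<lambda>x. f x - g x) \<longlongrightarrow> a - b) F"
proof (rule tendsto_fpsI)
  fix n
  have "eventually (\<lambda>x. f x $ n = a $ n) F" "eventually (\<lambda>x. g x $ n = b $ n) F"
    using assms by (auto simp: tendsto_fps_iff)
  then show "eventually (\<lambda>x. (f x - g x) $ n = (a - b) $ n) F"
    by eventually_elim auto
qed

lemma tendsto_power_fps:
  fixes f :: "_ \<Rightarrow> 'a::comm_ring_1 fps"
  assumes "(f \<longlongrightarrow> a) F"
  shows "((\<lambda>x. f x ^ n) \<longlongrightarrow> a ^ n) F"
  by (induction n) (auto intro: tendsto_mult_fps assms)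

lemma tendsto_compose_X_power:
  fixes f :: "_ \<Rightarrow> 'a::comm_ring_1 fps"
  assumes "(f \<longlongrightarrow> a) F"
  shows "((\<lambda>x. f x oo fps_X ^ d) \<longlongrightarrow> a oo fps_X ^ d) F"
  using assms by (auto simp: tendsto_fps_iff fps_nth_compose_X_power)

lemma fps_X_power_dvd_iff: "fps_X ^ K dvd (F :: 'a::comm_ring_1 fps) \<longleftrightarrow> (\<forall>k<K. F $ k = 0)"
proof
  assume "fps_X ^ K dvd F"
  then show "\<forall>k<K. F $ k = 0" by (auto simp: fps_X_power_mult_nth elim!: dvdE)
next
  assume "\<forall>k<K. F $ k = 0"
  then have "F = fps_X ^ K * fps_shift K F"
    by (auto simp: fps_eq_iff fps_X_power_mult_nth)
  then show "fps_X ^ K dvd F" by (metis dvd_triv_left)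
qed

definition euler_fin :: "nat \<Rightarrow> nat \<Rightarrow> 'a::comm_ring_1 fps" where
  "euler_fin d N = (\<Prod>i=1..N. 1 - fps_X ^ (d * i))"

text \<open>
The series \<open>E_d\<close> of the introduction, as the diagonal of the partial products: the factors after the \<open>k\<close>-th one no longer change the
coefficient of \<open>q^k\<close>.
\<close>
definition euler :: "nat \<Rightarrow> 'a::comm_ring_1 fps" where
  "euler d = Abs_fps (\<lambda>k. euler_fin d k $ k)"

lemma euler_fin_cong:
  assumes "1 \<le> d" "K \<le> N"
  shows "fps_X ^ Suc K dvd (euler_fin d N - euler_fin d K :: 'a::comm_ring_1 fps)"
  using assms(2)
proof (induction N rule: dec_induct)
  case (step N)
  have "Suc K \<le> d * Suc N" using step assms(1) by (metis Suc_le_mono le_trans mult_le_mono1 nat_mult_1)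
  then have "fps_X ^ Suc K dvd (fps_X ^ (d * Suc N) * euler_fin d N :: 'a fps)"
    by (intro dvd_mult2 le_imp_power_dvd)
  moreover have "euler_fin d (Suc N) - euler_fin d K
      = (euler_fin d N - euler_fin d K) - (fps_X ^ (d * Suc N) * euler_fin d N :: 'a fps)"
    by (simp add: euler_fin_def algebra_simps)
  ultimately show ?case using step.IH by (metis dvd_diff)
qed simp

lemma euler_fin_nth:
  assumes "1 \<le> d" "k \<le> N"
  shows "euler_fin d N $ k = (euler d :: 'a::comm_ring_1 fps) $ k"
  using euler_fin_cong[OF assms, where ?'a = 'a]
  by (simp add: fps_X_power_dvd_iff euler_def less_Suc_eq del: power_Suc)

lemma euler_fin_tendsto:
  assumes "1 \<le> d"
  shows "euler_fin d \<longlonglongrightarrow> (euler d :: 'a::comm_ring_1 fps)"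
proof (rule tendsto_fpsI)
  fix k
  show "eventually (\<lambda>N. euler_fin d N $ k = (euler d :: 'a fps) $ k) sequentially"
    using eventually_ge_at_top[of k] by eventually_elim (use assms in \<open>auto intro: euler_fin_nth\<close>)
qed

lemma euler_fin_nth_0: "1 \<le> d \<Longrightarrow> euler_fin d N $ 0 = 1"
  by (induction N) (auto simp: euler_fin_def)

lemma euler_nth_0: "1 \<le> d \<Longrightarrow> euler d $ 0 = 1"
  by (simp add: euler_def euler_fin_nth_0)

lemma euler_compose:
  assumes "1 \<le> d" "1 \<le> k"
  shows "euler d oo fps_X ^ k = (euler (d * k) :: 'a::idom fps)"
proof (rule tendsto_unique[OF sequentially_bot])
  show "(\<lambda>N. euler_fin d N oo fps_X ^ k) \<longlonglongrightarrow> (euler d oo fps_X ^ k :: 'a fps)"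
    by (intro tendsto_compose_X_power euler_fin_tendsto assms)
  have k0: "(fps_X ^ k :: 'a fps) $ 0 = 0" using assms by (simp add: fps_power_zeroth)
  have "fps_X ^ (d * i) oo fps_X ^ k = (fps_X ^ (d * k * i) :: 'a fps)" for i
  proof -
    have "fps_X ^ (d * i) oo fps_X ^ k = (fps_X oo fps_X ^ k :: 'a fps) ^ (d * i)"
      by (simp add: fps_compose_power[OF k0])
    also have "\<dots> = (fps_X ^ k) ^ (d * i)"
      using k0 by (simp add: fps_X_fps_compose_startby0)
    finally show ?thesis by (simp add: mult_ac flip: power_mult)
  qed
  then have "euler_fin d N oo fps_X ^ k = (euler_fin (d * k) N :: 'a fps)" for N
    unfolding euler_fin_def fps_compose_prod_distrib[OF k0]
    by (simp add: fps_compose_sub_distrib)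
  then show "(\<lambda>N. euler_fin d N oo fps_X ^ k) \<longlonglongrightarrow> (euler (d * k) :: 'a fps)"
    using euler_fin_tendsto[of "d * k"] assms by simp
qed

text \<open>
The sum of \<open>c n * q ^ e n\<close> over all integers \<open>n\<close>. It has this meaning when every fibre of \<open>e\<close> is finite.
\<close>
definition theta :: "(int \<Rightarrow> 'a::comm_ring_1) \<Rightarrow> (int \<Rightarrow> nat) \<Rightarrow> 'a fps" where
  "theta c e = Abs_fps (\<lambda>k. \<Sum>n | e n = k. c n)"

text \<open>
With \<open>(Q)_m\<close> for the product of \<open>1 - Q^i\<close> over \<open>1 \<le> i \<le> m\<close>, the binomial is
\<open>(Q)_(2N) / ((Q)_(N+n) (Q)_(N-n))\<close>, and all of these agree with \<open>(Q)_K\<close>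
modulo \<open>q^K\<close> with \<open>K = N - |n|\<close>. So \<open>(Q)_N\<close> is nearly an inverse of the binomial.
\<close>
lemma qbinom_cong:
  fixes n :: int
  assumes d: "1 \<le> d" and n: "\<bar>n\<bar> \<le> int N"
  shows "fps_X ^ (N - nat \<bar>n\<bar>) dvd
    (euler_fin d N * qbinom (fps_X ^ d) (N + N) (int N + n) - 1 :: 'a::field fps)"
proof -
  define K where "K = N - nat \<bar>n\<bar>"
  define g :: "'a fps" where "g = qbinom (fps_X ^ d) (N + N) (int N + n)"
  define i j where "i = nat (int N + n)" and "j = nat (int N - n)"
  define U :: "'a fps" where "U = euler_fin d K"
  have ij: "i + j = N + N" "int i = int N + n" using n by (auto simp: i_def j_def)
  have cong: "fps_X ^ K dvd (euler_fin d M - U)" if "K \<le> M" for M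
    using euler_fin_cong[OF d that] power_le_dvd[of "fps_X :: 'a fps" "Suc K" _ K] by (simp add: U_def)
  have prod: "(\<Prod>k=1..M. 1 - (fps_X ^ d) ^ k) = (euler_fin d M :: 'a fps)" for M
    by (simp add: euler_fin_def power_mult)
  have "g * euler_fin d i * euler_fin d j = euler_fin d (N + N)"
    using qbinom_mult_prods[of "fps_X ^ d :: 'a fps" i j] by (simp only: g_def ij prod)
  (* All four products are U modulo q^K, so g U^2 and U agree; U is a unit. *)
  then have "U * (U * g - 1)
      = (euler_fin d (N + N) - U) - g * ((euler_fin d i - U) * euler_fin d j + U * (euler_fin d j - U))"
    by (simp add: algebra_simps)
  moreover have "K \<le> N + N" "K \<le> i" "K \<le> j" "K \<le> N" using n by (auto simp: K_def i_def j_def)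
  ultimately have "fps_X ^ K dvd U * (U * g - 1)"
    by (simp add: cong dvd_diff dvd_add dvd_mult dvd_mult2)
  then have "fps_X ^ K dvd inverse U * (U * (U * g - 1))" by (rule dvd_mult)
  moreover have "inverse U * U = 1"
    using euler_fin_nth_0[OF d, where ?'a = 'a] by (intro inverse_mult_eq_1) (simp add: U_def)
  then have "inverse U * (U * (U * g - 1)) = U * g - 1" by (metis mult.assoc mult_1)
  moreover have "euler_fin d N * g - 1 = (U * g - 1) + (euler_fin d N - U) * g"
    by (simp add: algebra_simps)
  ultimately have "fps_X ^ K dvd euler_fin d N * g - 1"
    using cong[OF \<open>K \<le> N\<close>] by (metis dvd_add dvd_mult2)
  then show ?thesis by (simp add: K_def g_def)
qed

lemma finite_fibre:
  assumes "\<And>n. \<bar>n\<bar> \<le> int (e n) + 1"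
  shows "finite {n::int. e n = k}"
proof (rule finite_subset)
  show "{n. e n = k} \<subseteq> {- int k - 1..int k + 1}"
  proof
    fix n assume "n \<in> {n. e n = k}"
    then show "n \<in> {- int k - 1..int k + 1}" using assms[of n] by (auto simp: abs_le_iff)
  qed
qed simp

text \<open>
The approximation of the binomial is poor when \<open>|n|\<close> is close to \<open>N\<close>. The growth condition on \<open>e\<close> makes the
monomials with such \<open>n\<close> invisible in any fixed coefficient.
\<close>
lemma theta_limit:
  fixes c :: "int \<Rightarrow> 'a::field"
  assumes d: "1 \<le> d" and e: "\<And>n. \<bar>n\<bar> \<le> int (e n) + 1"
  shows "(\<lambda>N. euler_fin d N * (\<Sum>n=-int N..int N.
      qbinom (fps_X ^ d) (N + N) (int N + n) * (fps_const (c n) * fps_X ^ e n))) \<longlonglongrightarrow> theta c e"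
proof (rule tendsto_fpsI)
  fix k
  show "eventually (\<lambda>N. (euler_fin d N * (\<Sum>n=-int N..int N.
      qbinom (fps_X ^ d) (N + N) (int N + n) * (fps_const (c n) * fps_X ^ e n))) $ k = theta c e $ k)
      sequentially"
    using eventually_ge_at_top[of "2 * k + 2"]
  proof eventually_elim
    case (elim N)
    define r where "r n = (euler_fin d N * qbinom (fps_X ^ d) (N + N) (int N + n) - 1 :: 'a fps)" for n
    have r0: "(r n * (fps_const (c n) * fps_X ^ e n)) $ k = 0" if n: "n \<in> {-int N..int N}" for n
    proof (cases "e n \<le> k")
      case True
      then have "Suc k \<le> N - nat \<bar>n\<bar>" using e[of n] elim by linarith
      moreover have "fps_X ^ (N - nat \<bar>n\<bar>) dvd r n"
        unfolding r_def using n by (intro qbinom_cong d) auto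
      ultimately have "fps_X ^ Suc k dvd r n" by (meson dvd_trans le_imp_power_dvd)
      then have "fps_X ^ Suc k dvd r n * (fps_const (c n) * fps_X ^ e n)" by (rule dvd_mult2)
      then show ?thesis unfolding fps_X_power_dvd_iff by blast
    next
      case False
      then have "fps_X ^ Suc k dvd r n * (fps_const (c n) * fps_X ^ e n)"
        by (intro dvd_mult le_imp_power_dvd) auto
      then show ?thesis unfolding fps_X_power_dvd_iff by blast
    qed
    have "(euler_fin d N * (\<Sum>n=-int N..int N.
        qbinom (fps_X ^ d) (N + N) (int N + n) * (fps_const (c n) * fps_X ^ e n))) $ k
      = (\<Sum>n=-int N..int N. (fps_const (c n) * fps_X ^ e n + r n * (fps_const (c n) * fps_X ^ e n)) $ k)"
      unfolding sum_distrib_left fps_sum_nth r_def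
      by (intro sum.cong refl) (simp add: algebra_simps)
    also have "\<dots> = (\<Sum>n=-int N..int N. if e n = k then c n else 0)"
      by (intro sum.cong refl) (auto simp: r0)
    also have "\<dots> = (\<Sum>n\<in>{-int N..int N} \<inter> {n. e n = k}. c n)"
      by (simp add: sum.If_cases)
    also have "{-int N..int N} \<inter> {n. e n = k} = {n. e n = k}"
    proof -
      have "- int N \<le> n \<and> n \<le> int N" if "e n = k" for n
        using e[of n] elim that by (simp add: abs_le_iff)
      then show ?thesis by auto
    qed
    finally show ?case by (simp add: theta_def)
  qed
qed

section \<open>The triple product and its derivatives in z at z = 1\<close>

text \<open>
The variable \<open>z\<close> of the triple product is modelled as \<open>z = 1 + t\<close>, where \<open>t\<close> is the variable of an outer
power series ring over the power series in \<open>q\<close>. Then \<open>z\<close> is invertible, the constant coefficient in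
\<open>t\<close> is the value at \<open>z = 1\<close>, and the derivation \<open>z d/dz\<close> is available purely algebraically.
\<close>
definition zvar :: "'a::comm_ring_1 fps" where "zvar = 1 + fps_X"
definition zinv :: "'a::comm_ring_1 fps" where "zinv = Abs_fps (\<lambda>n. (- 1) ^ n)"
definition zderiv :: "'a::comm_ring_1 fps \<Rightarrow> 'a fps" where "zderiv F = zvar * fps_deriv F"

lemma zvar_zinv: "zvar * zinv = 1"
proof (rule fps_ext)
  fix n
  show "(zvar * zinv) $ n = (1 :: 'a fps) $ n"
    by (cases n) (auto simp: zvar_def zinv_def distrib_right)
qed

lemma zvar_0 [simp]: "zvar $ 0 = 1" and zinv_0 [simp]: "zinv $ 0 = 1"
  by (simp_all add: zvar_def zinv_def)

lemma zderiv_mult: "zderiv (F * G) = F * zderiv G + zderiv F * G"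
  by (simp add: zderiv_def algebra_simps)

lemma zderiv_add: "zderiv (F + G) = zderiv F + zderiv G"
  and zderiv_diff: "zderiv (F - G) = zderiv F - zderiv G"
  and zderiv_uminus: "zderiv (- F) = - zderiv F"
  and zderiv_const: "zderiv (fps_const c) = 0"
  and zderiv_1: "zderiv 1 = 0"
  and zderiv_sum: "zderiv (sum f A) = (\<Sum>x\<in>A. zderiv (f x))"
  by (simp_all add: zderiv_def algebra_simps fps_deriv_sum sum_distrib_left)

lemma zderiv_zvar: "zderiv zvar = zvar"
  by (simp add: zderiv_def zvar_def)

lemma zderiv_zinv: "zderiv zinv = - (zinv :: 'a::comm_ring_1 fps)"
proof -
  have "zderiv (zvar * zinv :: 'a fps) = 0" by (simp add: zvar_zinv zderiv_1)
  then have "zvar * zderiv zinv + zvar * (zinv :: 'a fps) = 0"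
    by (simp only: zderiv_mult zderiv_zvar)
  then have "zinv * (zvar * zderiv zinv + zvar * (zinv :: 'a fps)) = 0"
    by (simp only: mult_zero_right)
  moreover have "zinv * (zvar * zderiv zinv + zvar * zinv)
    = (zvar * zinv) * zderiv zinv + (zvar * zinv) * (zinv :: 'a fps)" by (simp only: algebra_simps)
  ultimately show ?thesis by (simp add: zvar_zinv eq_neg_iff_add_eq_0)
qed

lemma zderiv_monomial:
  "zderiv (zvar ^ i * zinv ^ j :: 'a::comm_ring_1 fps) = of_int (int i - int j) * (zvar ^ i * zinv ^ j)"
proof -
  have "zderiv (zvar ^ i) = (of_nat i * zvar ^ i :: 'a fps)"
    by (induction i) (auto simp: zderiv_1 zderiv_mult zderiv_zvar algebra_simps)
  moreover have "zderiv (zinv ^ j) = (- of_nat j * zinv ^ j :: 'a fps)"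
    by (induction j) (auto simp: zderiv_1 zderiv_mult zderiv_zinv algebra_simps)
  ultimately show ?thesis by (simp add: zderiv_mult algebra_simps)
qed

definition alt_sign :: "int \<Rightarrow> 'a::comm_ring_1" where
  "alt_sign n = (if even n then 1 else - 1)"

text \<open>
The product side of the triple product for \<open>a = - z q^s\<close> and \<open>b = - q^t / z\<close>, with \<open>N\<close> factors of each kind.
\<close>
definition jtp_prod :: "nat \<Rightarrow> nat \<Rightarrow> nat \<Rightarrow> complex fps fps" where
  "jtp_prod s t N = (\<Prod>k<N. 1 - zvar * fps_const (fps_X ^ ((s + t) * k + s)))
                  * (\<Prod>k<N. 1 - zinv * fps_const (fps_X ^ ((s + t) * k + t)))"

lemma qbinom_fps_const: "qbinom (fps_const Q) m k = fps_const (qbinom Q m k)"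
  by (induction m arbitrary: k) auto

text \<open>
The sum side has the monomials \<open>z^n\<close>, on which \<open>z d/dz\<close> acts as multiplication by \<open>n\<close>.
\<close>
lemma jtp_prod_moment:
  "(zderiv ^^ r) (jtp_prod s t N) $ 0 =
    (\<Sum>n=-int N..int N. qbinom (fps_X ^ (s + t)) (N + N) (int N + n) *
       (fps_const (alt_sign n * of_int n ^ r) * fps_X ^ (s * tri n + t * tri (n - 1))))"
proof -
  define x :: "complex fps fps" where "x = fps_const fps_X"
  define a b where "a = - (zvar * x ^ s)" and "b = - (zinv * x ^ t)"
  define m :: "int \<Rightarrow> complex fps fps" where "m n = zvar ^ tri n * zinv ^ tri (n - 1)" for n
  define g where "g n = qbinom (fps_X ^ (s + t) :: complex fps) (N + N) (int N + n)" for n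
  define X' where "X' n = (fps_X :: complex fps) ^ (s * tri n + t * tri (n - 1))" for n
  have ab: "x ^ (s + t) = a * b"
  proof -
    have "a * b = (zvar * zinv) * x ^ (s + t)"
      by (simp only: a_def b_def minus_mult_minus power_add mult_ac)
    then show ?thesis by (simp add: zvar_zinv)
  qed
  have trm: "a ^ tri n * b ^ tri (n - 1) = fps_const (fps_const (alt_sign n) * X' n) * m n" for n
  proof -
    have "even (tri n + tri (n - 1)) \<longleftrightarrow> even (int (tri n + tri (n - 1)))"
      by presburger
    also have "int (tri n + tri (n - 1)) = 2 * int (tri n) - n" by (simp add: tri_pred)
    finally have *: "even (tri n + tri (n - 1)) \<longleftrightarrow> even n" by simp
    have "a ^ tri n * b ^ tri (n - 1)
        = (- 1) ^ (tri n + tri (n - 1)) * (x ^ (s * tri n + t * tri (n - 1))) * m n"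
      unfolding a_def b_def m_def
      by (subst (1 2) power_minus) (simp add: power_mult_distrib power_add power_mult mult_ac)
    also have "(- 1) ^ (tri n + tri (n - 1)) = (fps_const (fps_const (alt_sign n)) :: complex fps fps)"
    proof -
      have "fps_const (- 1) = (- 1 :: complex fps)" "fps_const (- 1) = (- 1 :: complex fps fps)"
        by (metis fps_const_1_eq_1 fps_const_neg)+
      then show ?thesis using * by (cases "even n") (simp_all add: alt_sign_def)
    qed
    also have "x ^ (s * tri n + t * tri (n - 1)) = fps_const (X' n)"
      by (simp add: x_def X'_def)
    finally show ?thesis by simp
  qed
  have pw: "fps_const (fps_X ^ ((s + t) * k + u)) = x ^ u * (x ^ (s + t)) ^ k" for k u
    by (simp only: x_def fps_const_power fps_const_mult power_mult_distrib power_add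
        power_mult[symmetric] mult.commute distrib_left)
  have "jtp_prod s t N = (\<Prod>k<N. 1 + a * (x ^ (s + t)) ^ k) * (\<Prod>k<N. 1 + b * (x ^ (s + t)) ^ k)"
    unfolding jtp_prod_def pw a_def b_def by (simp add: mult.assoc)
  also have "\<dots> = (\<Sum>n=-int N..int N. fps_const (g n * (fps_const (alt_sign n) * X' n)) * m n)"
    unfolding finite_jacobi_triple_product[OF ab] trm
    by (intro sum.cong refl) (simp add: x_def qbinom_fps_const g_def mult.assoc flip: fps_const_mult)
  finally have J: "jtp_prod s t N = \<dots>" .
  have m: "zderiv (m n) = of_int n * m n" for n
    using zderiv_monomial[of "tri n" "tri (n - 1)"] by (simp add: m_def tri_pred)
  have "(zderiv ^^ r) (jtp_prod s t N)
     = (\<Sum>n=-int N..int N. fps_const (g n * (fps_const (alt_sign n * of_int n ^ r) * X' n)) * m n)"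
  proof (induction r)
    case 0
    then show ?case by (simp add: J)
  next
    case (Suc r)
    have "zderiv (fps_const (g n * (fps_const (alt_sign n * of_int n ^ r) * X' n)) * m n)
       = fps_const (g n * (fps_const (alt_sign n * of_int n ^ Suc r) * X' n)) * m n" for n
    proof -
      have "fps_const (fps_const (of_int n)) = (of_int n :: complex fps fps)"
        by (simp add: fps_of_int)
      then show ?thesis
        by (simp add: zderiv_mult zderiv_const m mult_ac flip: fps_const_mult)
    qed
    then show ?case using Suc by (simp add: zderiv_sum)
  qed
  then show ?thesis
    by (simp add: fps_sum_nth m_def g_def X'_def fps_power_zeroth)
qed

theorem jacobi_triple_product_moments:
  assumes "1 \<le> s"
  shows "(\<lambda>N. euler_fin (s + t) N * (zderiv ^^ r) (jtp_prod s t N) $ 0)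
     \<longlonglongrightarrow> theta (\<lambda>n. alt_sign n * of_int n ^ r) (\<lambda>n. s * tri n + t * tri (n - 1))"
proof -
  have "\<bar>n\<bar> \<le> int (s * tri n + t * tri (n - 1)) + 1" for n
  proof -
    have "tri n \<le> s * tri n + t * tri (n - 1)" using assms by (simp add: trans_le_add1)
    then show ?thesis using abs_le_tri[of n] by linarith
  qed
  then show ?thesis unfolding jtp_prod_moment using assms by (intro theta_limit) auto
qed

lemma fps_prod_nth_0: "prod f A $ 0 = (\<Prod>x\<in>A. f x $ 0)"
  for f :: "_ \<Rightarrow> 'a::comm_ring_1 fps"
  by (induction A rule: infinite_finite_induct) auto

text \<open>
For \<open>a = - z q\<close> and \<open>b = - 1/z\<close> the product contains the factor \<open>1 - 1/z\<close>, which vanishes at \<open>z = 1\<close> and has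
derivative 1 there. Hence the first derivative of the product at \<open>z = 1\<close> is the product of all other factors,
two copies of the Euler product; the third copy comes from the normalisation.
\<close>
theorem jacobi_euler_cubed:
  "(euler 1 :: complex fps) ^ 3 = theta (\<lambda>n. alt_sign n * of_int n) tri"
proof (rule tendsto_unique[OF sequentially_bot])
  (* The vanishing factor 1 - 1/z is the one with k = 0, so at least one factor is needed. *)
  have deriv: "zderiv (jtp_prod 1 0 (Suc N)) $ 0 = euler_fin 1 (Suc N) * euler_fin 1 N" for N
  proof -
    define A :: "complex fps fps" where "A = (\<Prod>k<Suc N. 1 - zvar * fps_const (fps_X ^ (k + 1)))"
    define B :: "complex fps fps" where "B = (\<Prod>k<N. 1 - zinv * fps_const (fps_X ^ (Suc k)))"
    have "jtp_prod 1 0 (Suc N) = A * ((1 - zinv) * B)"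
      unfolding jtp_prod_def A_def B_def
      by (subst (2) prod.lessThan_Suc_shift) simp
    then have "zderiv (jtp_prod 1 0 (Suc N)) $ 0 = A $ 0 * B $ 0"
      by (simp add: zderiv_mult zderiv_diff zderiv_1 zderiv_zinv)
    moreover have "A $ 0 = euler_fin 1 (Suc N)"
      unfolding A_def euler_fin_def fps_prod_nth_0
      by (rule prod.reindex_bij_witness[of _ "\<lambda>k. k - 1" Suc]) auto
    moreover have "B $ 0 = euler_fin 1 N"
      unfolding B_def euler_fin_def fps_prod_nth_0
      by (rule prod.reindex_bij_witness[of _ "\<lambda>k. k - 1" Suc]) auto
    ultimately show ?thesis by simp
  qed
  have "(\<lambda>N. euler_fin 1 N * zderiv (jtp_prod 1 0 N) $ 0)
      \<longlonglongrightarrow> theta (\<lambda>n. alt_sign n * of_int n) tri"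
    using jacobi_triple_product_moments[of 1 0 1] by simp
  then have "(\<lambda>N. euler_fin 1 (Suc N) * zderiv (jtp_prod 1 0 (Suc N)) $ 0)
      \<longlonglongrightarrow> theta (\<lambda>n. alt_sign n * of_int n) tri"
    by (rule LIMSEQ_Suc)
  then show "(\<lambda>N. euler_fin 1 (Suc N) * (euler_fin 1 (Suc N) * euler_fin 1 N))
      \<longlonglongrightarrow> theta (\<lambda>n. alt_sign n * (of_int n :: complex)) tri"
    by (simp only: deriv)
  have "(\<lambda>N. euler_fin 1 (Suc N) * (euler_fin 1 (Suc N) * euler_fin 1 N))
      \<longlonglongrightarrow> (euler 1 * (euler 1 * euler 1) :: complex fps)"
    by (intro tendsto_mult_fps LIMSEQ_Suc euler_fin_tendsto) auto
  then show "(\<lambda>N. euler_fin 1 (Suc N) * (euler_fin 1 (Suc N) * euler_fin 1 N))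
      \<longlonglongrightarrow> (euler 1 :: complex fps) ^ 3"
    by (simp add: power3_eq_cube mult.assoc)
qed

section \<open>Moments of the pentagonal number series\<close>

text \<open>
The generalised pentagonal number \<open>n (3 n + 1)/2\<close>, in the form in which it arises from the triple product.
\<close>
definition pent :: "int \<Rightarrow> nat" where "pent n = 2 * tri n + tri (n - 1)"

definition pent_moment :: "nat \<Rightarrow> complex fps" where
  "pent_moment r = theta (\<lambda>n. alt_sign n * of_int n ^ r) pent"

text \<open>
The expansion of \<open>q^n / (1 - q^n)^2\<close>.
\<close>
definition lambert :: "nat \<Rightarrow> complex fps" where
  "lambert n = Abs_fps (\<lambda>k. if n dvd k then of_nat (k div n) else 0)"

definition sigma_fps :: "complex fps" where
  "sigma_fps = Abs_fps (\<lambda>k. if k = 0 then 0 else \<Sum>d | d dvd k. of_nat d)"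

lemma one_minus_X_power_mult_nth: "((1 - fps_X ^ n) * F) $ k = F $ k - (if k < n then 0 else F $ (k - n))"
  for F :: "'a::comm_ring_1 fps"
  by (simp add: left_diff_distrib fps_X_power_mult_nth)

text \<open>
The expansion of \<open>q^n / (1 - q^n)\<close>.
\<close>
definition geometric :: "nat \<Rightarrow> complex fps" where
  "geometric n = Abs_fps (\<lambda>k. if 0 < k \<and> n dvd k then 1 else 0)"

lemma geometric_eq:
  assumes "1 \<le> n"
  shows "(1 - fps_X ^ n) * geometric n = fps_X ^ n"
proof (rule fps_ext)
  fix k
  show "((1 - fps_X ^ n) * geometric n) $ k = fps_X ^ n $ k"
    using assms by (cases "k \<le> n")
      (auto simp: one_minus_X_power_mult_nth geometric_def dvd_minus_self dest: dvd_imp_le)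
qed

lemma lambert_eq:
  assumes "1 \<le> n"
  shows "(1 - fps_X ^ n) ^ 2 * lambert n = fps_X ^ n"
proof -
  have "(1 - fps_X ^ n) * lambert n = geometric n"
  proof (rule fps_ext)
    fix k
    show "((1 - fps_X ^ n) * lambert n) $ k = geometric n $ k"
    proof (cases "k < n")
      case True
      then show ?thesis
        using assms by (auto simp: one_minus_X_power_mult_nth lambert_def geometric_def dest: dvd_imp_le)
    next
      case False
      then have "n dvd k \<longleftrightarrow> n dvd k - n" "k div n = Suc ((k - n) div n)" "0 < k"
        using assms by (auto simp: dvd_minus_self le_div_geq)
      then show ?thesis using False by (simp add: one_minus_X_power_mult_nth lambert_def geometric_def)
    qed
  qed
  then show ?thesis
    by (simp add: power2_eq_square mult.assoc geometric_eq[OF assms])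
qed

text \<open>
The coefficient of \<open>q^k\<close> is the sum of \<open>k div j\<close> over the divisors \<open>j\<close> of \<open>k\<close>, and the quotients are again the
divisors of \<open>k\<close>.
\<close>
lemma lambert_limit: "(\<lambda>N. \<Sum>j=1..N. lambert j) \<longlonglongrightarrow> sigma_fps"
proof (rule tendsto_fpsI)
  fix k
  show "eventually (\<lambda>N. (\<Sum>j=1..N. lambert j) $ k = sigma_fps $ k) sequentially"
    using eventually_ge_at_top[of k]
  proof eventually_elim
    case (elim N)
    show ?case
    proof (cases "k = 0")
      case False
      have "(\<Sum>j=1..N. lambert j) $ k = (\<Sum>j\<in>{1..N} \<inter> {j. j dvd k}. of_nat (k div j))"
        by (simp add: fps_sum_nth lambert_def sum.If_cases)
      also have "{1..N} \<inter> {j. j dvd k} = {j. j dvd k}"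
        using elim False by (auto simp: Suc_le_eq dvd_pos_nat) (metis dvd_imp_le gr0I le_trans)
      also have "(\<Sum>j | j dvd k. of_nat (k div j)) = (\<Sum>d | d dvd k. (of_nat d :: complex))"
        using False
        by (intro sum.reindex_bij_witness[of _ "\<lambda>d. k div d" "\<lambda>d. k div d"]) auto
      finally show ?thesis using False by (simp add: sigma_fps_def)
    qed (simp add: fps_sum_nth lambert_def sigma_fps_def)
  qed
qed

lemma geometric_limit: "(\<lambda>N. \<Sum>j=1..N. of_nat j * geometric j) \<longlonglongrightarrow> sigma_fps"
proof (rule tendsto_fpsI)
  fix k
  show "eventually (\<lambda>N. (\<Sum>j=1..N. of_nat j * geometric j) $ k = sigma_fps $ k) sequentially"
    using eventually_ge_at_top[of k]
  proof eventually_elim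
    case (elim N)
    show ?case
    proof (cases "k = 0")
      case False
      have nth: "(of_nat j * geometric j) $ k = (if j dvd k then of_nat j else 0)" for j
        using False by (simp add: geometric_def)
      have "(\<Sum>j=1..N. of_nat j * geometric j) $ k = (\<Sum>j\<in>{1..N} \<inter> {j. j dvd k}. of_nat j)"
        unfolding fps_sum_nth nth by (simp add: sum.If_cases)
      also have "{1..N} \<inter> {j. j dvd k} = {j. j dvd k}"
        using elim False by (auto simp: Suc_le_eq dvd_pos_nat) (metis dvd_imp_le gr0I le_trans)
      finally show ?thesis using False by (simp add: sigma_fps_def)
    qed (simp add: fps_sum_nth geometric_def sigma_fps_def)
  qed
qed

lemma lambert_compose: "1 \<le> m \<Longrightarrow> 1 \<le> n \<Longrightarrow> lambert n oo fps_X ^ m = lambert (m * n)"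
  by (auto simp: fps_eq_iff fps_nth_compose_X_power lambert_def div_mult2_eq dvd_div_iff_mult
      mult.commute elim: dvdE)

text \<open>
The series \<open>m\<close> is \<open>(z d/dz)^2 log F\<close> at \<open>z = 1\<close>, in a form without quotients. It is additive over products.
\<close>
definition log_deriv2 :: "complex fps fps \<Rightarrow> complex fps \<Rightarrow> bool" where
  "log_deriv2 F m \<longleftrightarrow> F $ 0 * zderiv (zderiv F) $ 0 - (zderiv F $ 0)\<^sup>2 = (F $ 0)\<^sup>2 * m"

lemma log_deriv2_mult:
  assumes "log_deriv2 F m" "log_deriv2 G m'"
  shows "log_deriv2 (F * G) (m + m')"
proof -
  have "(F * G) $ 0 * zderiv (zderiv (F * G)) $ 0 - (zderiv (F * G) $ 0)\<^sup>2
    = (G $ 0)\<^sup>2 * (F $ 0 * zderiv (zderiv F) $ 0 - (zderiv F $ 0)\<^sup>2)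
    + (F $ 0)\<^sup>2 * (G $ 0 * zderiv (zderiv G) $ 0 - (zderiv G $ 0)\<^sup>2)"
    by (simp add: zderiv_mult zderiv_add algebra_simps power2_eq_square)
  also have "\<dots> = ((F * G) $ 0)\<^sup>2 * (m + m')"
    using assms unfolding log_deriv2_def by (simp add: algebra_simps power2_eq_square)
  finally show ?thesis by (simp add: log_deriv2_def)
qed

lemma log_deriv2_1: "log_deriv2 1 0"
  by (simp add: log_deriv2_def zderiv_1 zderiv_def)

lemma log_deriv2_prod:
  "(\<And>i. i \<in> A \<Longrightarrow> log_deriv2 (f i) (m i)) \<Longrightarrow> log_deriv2 (prod f A) (sum m A)"
  by (induction A rule: infinite_finite_induct) (auto simp: log_deriv2_1 log_deriv2_mult)

lemma log_deriv2_factor: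
  assumes "1 \<le> n"
  shows "log_deriv2 (1 - zvar * fps_const (fps_X ^ n)) (- lambert n)"
    and "log_deriv2 (1 - zinv * fps_const (fps_X ^ n)) (- lambert n)"
  using lambert_eq[OF assms]
  by (simp_all add: log_deriv2_def zderiv_diff zderiv_1 zderiv_mult zderiv_const zderiv_zvar zderiv_zinv
      zderiv_uminus) (simp_all add: algebra_simps power2_eq_square)

lemma pent_moment_limit:
  "(\<lambda>N. euler_fin 3 N * (zderiv ^^ r) (jtp_prod 2 1 N) $ 0) \<longlonglongrightarrow> pent_moment r"
  using jacobi_triple_product_moments[of 2 1 r] by (simp add: pent_moment_def pent_def[abs_def])

lemma euler_fin_trisect:
  "(euler_fin 1 (3 * N) :: 'a::comm_ring_1 fps)
     = euler_fin 3 N * ((\<Prod>k<N. 1 - fps_X ^ (3 * k + 2)) * (\<Prod>k<N. 1 - fps_X ^ (3 * k + 1)))"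
proof (induction N)
  case (Suc N)
  have "3 * Suc N = Suc (Suc (Suc (3 * N)))" by simp
  then have s1: "euler_fin 1 (3 * Suc N) = euler_fin 1 (3 * N) * (1 - fps_X ^ (3 * N + 1)) *
     (1 - fps_X ^ (3 * N + 2)) * (1 - fps_X ^ (3 * N + 3) :: 'a fps)"
    by (simp only: euler_fin_def) (simp add: eval_nat_numeral)
  have s3: "euler_fin 3 (Suc N) = euler_fin 3 N * (1 - fps_X ^ (3 * N + 3) :: 'a fps)"
    by (simp add: euler_fin_def add.commute)
  show ?case unfolding s1 s3 Suc.IH prod.lessThan_Suc by (simp only: mult_ac)
qed (simp add: euler_fin_def)

lemma subseq_3: "filterlim (\<lambda>N::nat. 3 * N) at_top at_top"
  by (rule filterlim_subseq) (auto simp: strict_mono_def)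

lemma jtp_prod_0:
  "jtp_prod s t N $ 0 = (\<Prod>k<N. 1 - fps_X ^ ((s + t) * k + s)) * (\<Prod>k<N. 1 - fps_X ^ ((s + t) * k + t))"
  by (simp add: jtp_prod_def fps_prod_nth_0)

text \<open>
Euler's pentagonal number theorem. At \<open>z = 1\<close> the two products run over the exponents that are 1 and 2 modulo
3, and the normalising factor supplies the multiples of 3.
\<close>
theorem euler_pentagonal: "euler 1 = pent_moment 0"
proof (rule tendsto_unique[OF sequentially_bot])
  show "(\<lambda>N. euler_fin 3 N * jtp_prod 2 1 N $ 0) \<longlonglongrightarrow> pent_moment 0"
    using pent_moment_limit[of 0] by simp
  have "(\<lambda>N. euler_fin 1 (3 * N)) \<longlonglongrightarrow> (euler 1 :: complex fps)"
    by (rule filterlim_compose[OF euler_fin_tendsto subseq_3]) simp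
  moreover have "euler_fin 3 N * jtp_prod 2 1 N $ 0 = euler_fin 1 (3 * N)" for N
    unfolding euler_fin_trisect jtp_prod_0 by simp
  ultimately show "(\<lambda>N. euler_fin 3 N * jtp_prod 2 1 N $ 0) \<longlonglongrightarrow> euler 1"
    by simp
qed

text \<open>
The left-hand side divided by \<open>(pent_moment 0)^2\<close> is the second logarithmic derivative of the
triple product at \<open>z = 1\<close>. Every factor contributes \<open>- q^n / (1 - q^n)^2\<close>, with \<open>n\<close> running over the numbers not
divisible by 3; the sum over all \<open>n\<close> is the divisor sum series, and its part over the multiples of 3 is
that series in \<open>q^3\<close>.
\<close>
theorem pent_moment_wronskian:
  "pent_moment 0 * pent_moment 2 - pent_moment 1 ^ 2 = pent_moment 0 ^ 2 * ((sigma_fps oo fps_X ^ 3) - sigma_fps)"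
proof (rule tendsto_unique[OF sequentially_bot])
  define J where "J r N = euler_fin 3 N * (zderiv ^^ r) (jtp_prod 2 1 N) $ 0" for r N
  have lim: "J r \<longlonglongrightarrow> pent_moment r" for r unfolding J_def by (rule pent_moment_limit)
  define L where "L N = ((\<Sum>j=1..N. lambert j) oo fps_X ^ 3) - (\<Sum>j=1..3 * N. lambert j)" for N
  have L: "L N = (\<Sum>k<N. - lambert (3 * k + 2)) + (\<Sum>k<N. - lambert (3 * k + 1))" for N
  proof (induction N)
    case (Suc N)
    have "3 * Suc N = Suc (Suc (Suc (3 * N)))" by simp
    then have "(\<Sum>j=1..3 * Suc N. lambert j) = (\<Sum>j=1..3 * N. lambert j) + lambert (3 * N + 1)
       + lambert (3 * N + 2) + lambert (3 * N + 3)"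
      by (simp only:) (simp add: eval_nat_numeral)
    moreover have "(\<Sum>j=1..Suc N. lambert j) oo fps_X ^ 3
        = ((\<Sum>j=1..N. lambert j) oo fps_X ^ 3) + lambert (3 * N + 3)"
      using lambert_compose[of 3 "Suc N"] by (simp add: fps_compose_add_distrib add.commute)
    ultimately show ?case using Suc by (simp add: L_def)
  qed (simp add: L_def)
  have "log_deriv2 (jtp_prod 2 1 N) (L N)" for N
  proof -
    have "jtp_prod 2 1 N = (\<Prod>k<N. 1 - zvar * fps_const (fps_X ^ (3 * k + 2)))
        * (\<Prod>k<N. 1 - zinv * fps_const (fps_X ^ (3 * k + 1)))"
      by (simp add: jtp_prod_def)
    also have "log_deriv2 \<dots> (L N)"
      unfolding L by (intro log_deriv2_mult log_deriv2_prod log_deriv2_factor) simp_all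
    finally show ?thesis .
  qed
  note log_deriv2 = this
  have *: "J 0 N * J 2 N - J 1 N ^ 2 = J 0 N ^ 2 * L N" for N
  proof -
    let ?e = "euler_fin 3 N :: complex fps" and ?F = "jtp_prod 2 1 N"
    have "J 0 N * J 2 N - J 1 N ^ 2
        = ?e\<^sup>2 * (?F $ 0 * zderiv (zderiv ?F) $ 0 - (zderiv ?F $ 0)\<^sup>2)"
      by (simp add: J_def numeral_2_eq_2 algebra_simps)
    also have "\<dots> = J 0 N ^ 2 * L N"
      using log_deriv2[of N] by (simp add: J_def log_deriv2_def power_mult_distrib)
    finally show ?thesis .
  qed
  have "(\<lambda>N. J 0 N * J 2 N - J 1 N ^ 2) \<longlonglongrightarrow> pent_moment 0 * pent_moment 2 - pent_moment 1 ^ 2"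
    by (intro tendsto_diff_fps tendsto_mult_fps tendsto_power_fps lim)
  then show "(\<lambda>N. J 0 N ^ 2 * L N) \<longlonglongrightarrow> pent_moment 0 * pent_moment 2 - pent_moment 1 ^ 2"
    by (simp only: *)
  have "(\<lambda>N. \<Sum>j=1..3 * N. lambert j) \<longlonglongrightarrow> sigma_fps"
    by (rule filterlim_compose[OF lambert_limit subseq_3])
  then show "(\<lambda>N. J 0 N ^ 2 * L N) \<longlonglongrightarrow> pent_moment 0 ^ 2 * ((sigma_fps oo fps_X ^ 3) - sigma_fps)"
    unfolding L_def
    by (intro tendsto_diff_fps tendsto_mult_fps tendsto_power_fps tendsto_compose_X_power
        lim lambert_limit)
qed

section \<open>The derivation q d/dq\<close>

definition qderiv :: "complex fps \<Rightarrow> complex fps" where "qderiv F = fps_X * fps_deriv F"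

lemma qderiv_nth [simp]: "qderiv F $ n = of_nat n * F $ n"
  by (cases n) (auto simp: qderiv_def)

lemma qderiv_mult: "qderiv (F * G) = F * qderiv G + qderiv F * G"
  and qderiv_diff: "qderiv (F - G) = qderiv F - qderiv G"
  and qderiv_power: "qderiv (F ^ n) = of_nat n * F ^ (n - 1) * qderiv F"
  by (simp_all add: qderiv_def fps_deriv_power' algebra_simps)

lemma tendsto_qderiv:
  "(f \<longlongrightarrow> F) \<F> \<Longrightarrow> ((\<lambda>x. qderiv (f x)) \<longlongrightarrow> qderiv F) \<F>"
  by (auto simp: tendsto_fps_iff elim: eventually_mono)

lemma qderiv_theta: "qderiv (theta c e) = theta (\<lambda>n. of_nat (e n) * c n) e"
  by (auto simp: fps_eq_iff theta_def sum_distrib_left intro!: sum.cong)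

text \<open>
The logarithmic derivative of \<open>1 - q^n\<close> is \<open>- n q^n / (1 - q^n)\<close>.
\<close>
theorem qderiv_euler: "qderiv (euler 1) = - euler 1 * sigma_fps"
proof (rule tendsto_unique[OF sequentially_bot])
  have fin: "qderiv (euler_fin 1 N) = - euler_fin 1 N * (\<Sum>j=1..N. of_nat j * geometric j)" for N
  proof (induction N)
    case 0
    then show ?case by (simp add: euler_fin_def qderiv_def)
  next
    case (Suc N)
    let ?u = "1 - fps_X ^ Suc N :: complex fps"
    have u: "euler_fin 1 (Suc N) = euler_fin 1 N * ?u" by (simp add: euler_fin_def)
    have u': "qderiv ?u = - (of_nat (Suc N) * (?u * geometric (Suc N)))"
      unfolding geometric_eq[OF le_add1[of 1 N, unfolded plus_1_eq_Suc]] by (simp add: fps_eq_iff del: power_Suc of_nat_Suc)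
    then show ?case
      unfolding u qderiv_mult Suc.IH u'
      by (simp add: algebra_simps del: of_nat_Suc power_Suc)
  qed
  show "(\<lambda>N. qderiv (euler_fin 1 N)) \<longlonglongrightarrow> qderiv (euler 1)"
    by (intro tendsto_qderiv euler_fin_tendsto) simp
  have "(\<lambda>N. (0 - euler_fin 1 N) * (\<Sum>j=1..N. of_nat j * geometric j)) \<longlonglongrightarrow> (0 - euler 1) * sigma_fps"
    by (intro tendsto_mult_fps tendsto_diff_fps tendsto_const euler_fin_tendsto geometric_limit) simp
  then show "(\<lambda>N. qderiv (euler_fin 1 N)) \<longlonglongrightarrow> - euler 1 * sigma_fps"
    unfolding fin by simp
qed

lemma int_pent: "2 * int (pent n) = n * (3 * n + 1)"
  using int_tri[of n] by (simp add: pent_def tri_pred algebra_simps)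

text \<open>
The series called \<open>P\<close> in the introduction.
\<close>
definition pent_weighted :: "complex fps" where
  "pent_weighted = theta (\<lambda>n. alt_sign n * of_int (6 * n + 1)) pent"

lemma theta_add: "theta (\<lambda>n. c n + c' n) e = theta c e + theta c' e"
  by (simp add: fps_eq_iff theta_def sum.distrib)

lemma theta_cmult: "theta (\<lambda>n. a * c n) e = fps_const a * theta c e"
  by (simp add: fps_eq_iff theta_def sum_distrib_left)

lemma pent_weighted_eq: "pent_weighted = pent_moment 0 + 6 * pent_moment 1"
proof -
  have "pent_weighted = theta (\<lambda>n. alt_sign n * of_int n ^ 0 + 6 * (alt_sign n * of_int n ^ 1)) pent"
    by (simp add: pent_weighted_def algebra_simps)
  also have "\<dots> = pent_moment 0 + 6 * pent_moment 1"
    unfolding theta_add theta_cmult pent_moment_def by (simp add: numeral_fps_const)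
  finally show ?thesis .
qed

text \<open>
The heat equation for the pentagonal series: \<open>q d/dq\<close> multiplies a term by its exponent
\<open>n (3 n + 1)/2\<close>, which is a quadratic polynomial in \<open>n\<close>.
\<close>
lemma qderiv_pent_moment_0: "2 * qderiv (pent_moment 0) = 3 * pent_moment 2 + pent_moment 1"
proof -
  have pent: "of_nat (pent n) * 2 = 3 * of_int n ^ 2 + (of_int n :: complex)" for n
  proof -
    have "of_int (2 * int (pent n)) = (of_int (n * (3 * n + 1)) :: complex)"
      by (simp only: int_pent)
    then show ?thesis by (simp add: algebra_simps power2_eq_square)
  qed
  have "2 * qderiv (pent_moment 0) = theta (\<lambda>n. 2 * (of_nat (pent n) * (alt_sign n * of_int n ^ 0))) pent"
    unfolding pent_moment_def qderiv_theta theta_cmult by (simp add: numeral_fps_const)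
  also have "(\<lambda>n. 2 * (of_nat (pent n) * (alt_sign n * of_int n ^ 0)))
     = (\<lambda>n. 3 * (alt_sign n * of_int n ^ 2) + alt_sign n * (of_int n :: complex) ^ 1)"
    using pent by (auto simp: fun_eq_iff algebra_simps)
  also have "theta \<dots> pent = 3 * pent_moment 2 + pent_moment 1"
    unfolding theta_add theta_cmult pent_moment_def by (simp add: numeral_fps_const)
  finally show ?thesis .
qed

text \<open>
With the moments \<open>S_r\<close> one has \<open>P = S_0 + 6 S_1\<close>, and \<open>S_1^2\<close> can be replaced by means of
\<open>pent_moment_wronskian\<close>. What remains is linear in \<open>S_1 + 3 S_2\<close>, hence in the derivative of the Euler product.
\<close>
theorem pent_weighted_squared:
  "pent_weighted\<^sup>2 = (euler 1)\<^sup>2 * (1 + 12 * sigma_fps - 36 * (sigma_fps oo fps_X ^ 3))"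
proof -
  define E S1 S2 s3 where "E = pent_moment 0" and "S1 = pent_moment 1" and "S2 = pent_moment 2"
    and "s3 = sigma_fps oo fps_X ^ 3"
  have W: "E * S2 - S1\<^sup>2 = E\<^sup>2 * (s3 - sigma_fps)"
    using pent_moment_wronskian by (simp add: E_def S1_def S2_def s3_def)
  have D: "3 * S2 + S1 = - (2 * E * sigma_fps)"
    using qderiv_pent_moment_0 qderiv_euler
    unfolding euler_pentagonal by (simp add: E_def S1_def S2_def mult.assoc)
  have "pent_weighted\<^sup>2 = E\<^sup>2 + 12 * E * (3 * S2 + S1) - 36 * (E * S2 - S1\<^sup>2)"
    by (simp add: pent_weighted_eq E_def S1_def algebra_simps power2_eq_square)
  also have "\<dots> = E\<^sup>2 * (1 + 12 * sigma_fps - 36 * s3)"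
    unfolding W D by (simp add: algebra_simps power2_eq_square)
  finally show ?thesis unfolding euler_pentagonal by (simp add: E_def s3_def)
qed

section \<open>Trisection of the cube of the Euler product\<close>

text \<open>
The third class is written with negative \<open>m\<close>, because then the classes 0 and 2 modulo 3 have the same
triangular exponents.
\<close>
lemma theta_trisect:
  assumes "\<And>k. finite {n. e n = k}"
  shows "theta c e = theta (\<lambda>m. c (3 * m)) (\<lambda>m. e (3 * m))
     + theta (\<lambda>m. c (3 * m + 1)) (\<lambda>m. e (3 * m + 1))
     + theta (\<lambda>m. c (- 3 * m - 1)) (\<lambda>m. e (- 3 * m - 1))"
proof (rule fps_ext)
  fix k
  define A where "A f = f ` {m::int. e (f m) = k}" for f :: "int \<Rightarrow> int"
  have sum_A: "sum c (A f) = (\<Sum>m | e (f m) = k. c (f m))" if "inj f" for f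
    unfolding A_def using that by (subst sum.reindex) (auto intro: inj_on_subset)
  have "{n. e n = k} = A (\<lambda>m. 3 * m) \<union> A (\<lambda>m. 3 * m + 1) \<union> A (\<lambda>m. - 3 * m - 1)"
  proof (intro equalityI subsetI)
    fix n assume n: "n \<in> {n. e n = k}"
    have "n mod 3 = 0 \<or> n mod 3 = 1 \<or> n mod 3 = 2" by presburger
    then consider m where "n = 3 * m" | m where "n = 3 * m + 1" | m where "n = - 3 * m - 1"
    proof (elim disjE)
      assume "n mod 3 = 0" then have "n = 3 * (n div 3)" by presburger
      then show thesis using that by blast
    next
      assume "n mod 3 = 1" then have "n = 3 * (n div 3) + 1" by presburger
      then show thesis using that by blast
    next
      assume "n mod 3 = 2" then have "n = - 3 * (- (n div 3) - 1) - 1" by presburger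
      then show thesis using that by blast
    qed
    then show "n \<in> A (\<lambda>m. 3 * m) \<union> A (\<lambda>m. 3 * m + 1) \<union> A (\<lambda>m. - 3 * m - 1)"
      using n by cases (auto simp: A_def)
  qed (auto simp: A_def)
  moreover have "finite (A f)" for f
    using assms[of k] unfolding A_def by (rule finite_subset[rotated]) blast
  moreover have mods: "A (\<lambda>m. 3 * m) \<subseteq> {n. n mod 3 = 0}" "A (\<lambda>m. 3 * m + 1) \<subseteq> {n. n mod 3 = 1}"
    "A (\<lambda>m. - 3 * m - 1) \<subseteq> {n. n mod 3 = 2}"
    unfolding A_def by (intro image_subsetI CollectI; presburger)+
  then have "A (\<lambda>m. 3 * m) \<inter> A (\<lambda>m. 3 * m + 1) = {}"
    "(A (\<lambda>m. 3 * m) \<union> A (\<lambda>m. 3 * m + 1)) \<inter> A (\<lambda>m. - 3 * m - 1) = {}"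
  proof -
    have "{n::int. n mod 3 = 0} \<inter> {n. n mod 3 = 1} = {}" "{n::int. n mod 3 = 0} \<inter> {n. n mod 3 = 2} = {}"
      "{n::int. n mod 3 = 1} \<inter> {n. n mod 3 = 2} = {}" by auto
    with mods show "A (\<lambda>m. 3 * m) \<inter> A (\<lambda>m. 3 * m + 1) = {}"
      "(A (\<lambda>m. 3 * m) \<union> A (\<lambda>m. 3 * m + 1)) \<inter> A (\<lambda>m. - 3 * m - 1) = {}"
      by blast+
  qed
  ultimately have "sum c {n. e n = k} = sum c (A (\<lambda>m. 3 * m)) + sum c (A (\<lambda>m. 3 * m + 1))
     + sum c (A (\<lambda>m. - 3 * m - 1))"
    by (simp add: sum.union_disjoint)
  also have "\<dots> = (\<Sum>m | e (3 * m) = k. c (3 * m)) + (\<Sum>m | e (3 * m + 1) = k. c (3 * m + 1))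
     + (\<Sum>m | e (- 3 * m - 1) = k. c (- 3 * m - 1))"
    by (intro arg_cong2[of _ _ _ _ "(+)"] sum_A) (auto simp: inj_def)
  finally show "theta c e $ k = (theta (\<lambda>m. c (3 * m)) (\<lambda>m. e (3 * m))
     + theta (\<lambda>m. c (3 * m + 1)) (\<lambda>m. e (3 * m + 1))
     + theta (\<lambda>m. c (- 3 * m - 1)) (\<lambda>m. e (- 3 * m - 1))) $ k"
    by (simp add: theta_def)
qed

lemma theta_compose: "1 \<le> d \<Longrightarrow> theta c (\<lambda>n. d * e n) = theta c e oo fps_X ^ d"
  by (auto simp: fps_eq_iff theta_def fps_nth_compose_X_power elim!: dvdE
      intro!: sum.cong sum.neutral)

lemma theta_shift: "theta c (\<lambda>n. Suc (e n)) = fps_X * theta c e"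
  by (auto simp: fps_eq_iff theta_def gr0_conv_Suc)

text \<open>
The terms of index \<open>n\<close> and \<open>- 1 - n\<close> have the same exponent and opposite signs.
\<close>
lemma theta_alt_tri: "theta alt_sign tri = (0 :: complex fps)"
proof (rule fps_ext)
  fix k
  have refl: "tri (- 1 - n) = tri n" for n
    by (simp add: tri_def algebra_simps)
  have "(\<Sum>n | tri n = k. alt_sign n) = (\<Sum>n | tri n = k. - alt_sign n :: complex)"
    by (rule sum.reindex_bij_witness[of _ "\<lambda>n. - 1 - n" "\<lambda>n. - 1 - n"])
       (auto simp: refl alt_sign_def)
  then show "theta alt_sign tri $ k = (0 :: complex fps) $ k"
    by (simp add: theta_def sum_negf)
qed

text \<open>
In Jacobi's series, the indices \<open>3 m\<close> and \<open>- 3 m - 1\<close> have exponent \<open>3 m (3 m + 1)/2\<close>, and together the weight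
\<open>6 m + 1\<close>. The indices \<open>3 m + 1\<close> have exponent \<open>9 m (m + 1)/2 + 1\<close> and reproduce Jacobi's series in \<open>q^9\<close>.
\<close>
theorem euler_cubed_trisect:
  "euler 1 ^ 3 = (pent_weighted oo fps_X ^ 3) - 3 * fps_X * euler 9 ^ 3"
proof -
  let ?c = "\<lambda>n. alt_sign n * of_int n :: complex"
  have t0: "tri (3 * m) = 3 * pent m" for m
  proof -
    have "2 * int (tri (3 * m)) = 2 * int (3 * pent m)"
      using int_tri[of "3 * m"] int_pent[of m] by (simp add: algebra_simps)
    then show ?thesis by (simp only: mult_cancel_left of_nat_eq_iff) simp
  qed
  have t1: "tri (3 * m + 1) = Suc (9 * tri m)" for m
  proof -
    have "2 * int (tri (3 * m + 1)) = 2 * int (Suc (9 * tri m))"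
      using int_tri[of "3 * m + 1"] int_tri[of m] by (simp add: algebra_simps)
    then show ?thesis by (simp only: mult_cancel_left of_nat_eq_iff) simp
  qed
  have t2: "tri (- 3 * m - 1) = 3 * pent m" for m
  proof -
    have "2 * int (tri (- 3 * m - 1)) = 2 * int (3 * pent m)"
      using int_tri[of "- 3 * m - 1"] int_pent[of m] by (simp add: algebra_simps)
    then show ?thesis by (simp only: mult_cancel_left of_nat_eq_iff) simp
  qed
  have "euler 1 ^ 3 = theta ?c tri" by (rule jacobi_euler_cubed)
  also have "\<dots> = theta (\<lambda>m. ?c (3 * m)) (\<lambda>m. tri (3 * m))
     + theta (\<lambda>m. ?c (3 * m + 1)) (\<lambda>m. tri (3 * m + 1))
     + theta (\<lambda>m. ?c (- 3 * m - 1)) (\<lambda>m. tri (- 3 * m - 1))"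
    by (intro theta_trisect finite_fibre abs_le_tri)
  also have "\<dots> = theta (\<lambda>m. ?c (3 * m) + ?c (- 3 * m - 1)) (\<lambda>m. 3 * pent m)
     + theta (\<lambda>m. ?c (3 * m + 1)) (\<lambda>m. Suc (9 * tri m))"
    unfolding t0 t1 t2 theta_add by simp
  also have "(\<lambda>m. ?c (3 * m) + ?c (- 3 * m - 1)) = (\<lambda>m. alt_sign m * of_int (6 * m + 1))"
    by (auto simp: fun_eq_iff alt_sign_def)
  also have "theta \<dots> (\<lambda>m. 3 * pent m) = pent_weighted oo fps_X ^ 3"
    by (simp add: theta_compose pent_weighted_def)
  also have "(\<lambda>m. ?c (3 * m + 1)) = (\<lambda>m. - 3 * ?c m + - 1 * alt_sign m)"
    by (auto simp: fun_eq_iff alt_sign_def)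
  also have "theta \<dots> (\<lambda>m. Suc (9 * tri m)) = fps_X * (theta (\<lambda>m. - 3 * ?c m + - 1 * alt_sign m) tri oo fps_X ^ 9)"
    by (simp only: theta_shift theta_compose)
  also have "theta (\<lambda>m. - 3 * ?c m + - 1 * alt_sign m) tri = - 3 * euler 1 ^ 3"
    unfolding theta_add theta_cmult theta_alt_tri jacobi_euler_cubed
    by (simp add: numeral_fps_const)
  also have "- 3 * euler 1 ^ 3 oo fps_X ^ 9 = - 3 * (euler 9 ^ 3 :: complex fps)"
  proof -
    have "(- 3 :: complex fps) oo fps_X ^ 9 = - 3"
      by (simp add: numeral_fps_const fps_compose_uminus)
    then show ?thesis
      using euler_compose[of 1 9, where ?'a = complex]
      by (simp add: fps_compose_mult_distrib fps_compose_uminus fps_compose_power[symmetric]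
          numeral_fps_const)
  qed
  finally show ?thesis by simp
qed

section \<open>Conjugates under a cube root of unity\<close>

lemma cube_eq_1:
  fixes w :: "'a::comm_ring_1"
  assumes "w\<^sup>2 + w + 1 = 0"
  shows "w * (w * w) = 1"
proof -
  have w: "w + w * w = - 1"
    using assms by (simp add: power2_eq_square eq_neg_iff_add_eq_0 add_ac)
  have "w * (w * w) = w * (w + w * w) - w * w" by (simp add: algebra_simps)
  also have "\<dots> = w * (- 1) - w * w" by (simp only: w)
  also have "\<dots> = - (w + w * w)" by simp
  also have "\<dots> = 1" unfolding w by simp
  finally show ?thesis .
qed

definition omega :: complex where "omega = Complex (- 1 / 2) (sqrt 3 / 2)"

lemma omega_eq: "omega\<^sup>2 + omega + 1 = 0"
  by (simp add: omega_def complex_eq_iff power2_eq_square)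

lemma omega_cubed: "omega ^ 3 = 1"
  using cube_eq_1[OF omega_eq] by (simp add: power3_eq_cube mult.assoc)

definition rot :: "complex fps \<Rightarrow> complex fps" where
  "rot F = F oo (fps_const omega * fps_X)"

lemma rot_nth [simp]: "rot F $ n = omega ^ n * F $ n"
  by (simp add: rot_def)

lemma rot_mult: "rot (F * G) = rot F * rot G"
  by (simp add: rot_def fps_compose_mult_distrib)

lemma rot_diff: "rot (F - G) = rot F - rot G"
  by (simp add: fps_eq_iff algebra_simps)

lemma rot_const_mult: "rot (fps_const c * F) = fps_const c * rot F"
  by (simp add: fps_eq_iff)

lemma rot_X_power: "rot (fps_X ^ n) = fps_const (omega ^ n) * fps_X ^ n"
  by (auto simp: fps_eq_iff)

lemma rot_X: "rot fps_X = fps_const omega * fps_X"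
  using rot_X_power[of 1] by simp

lemma rot_1: "rot 1 = 1"
  by (auto simp: fps_eq_iff)

lemma rot_compose: "rot (F oo fps_X ^ 3) = F oo fps_X ^ 3"
  by (auto simp: fps_eq_iff fps_nth_compose_X_power power_mult omega_cubed elim!: dvdE)

lemma tendsto_rot: "(f \<longlongrightarrow> F) \<F> \<Longrightarrow> ((\<lambda>x. rot (f x)) \<longlongrightarrow> rot F) \<F>"
  by (auto simp: tendsto_fps_iff elim: eventually_mono)

text \<open>
The norm from the power series in \<open>q\<close> to the power series in \<open>q^3\<close>.
\<close>
definition cyclic_norm :: "complex fps \<Rightarrow> complex fps" where
  "cyclic_norm F = F * rot F * rot (rot F)"

lemma cyclic_norm_mult: "cyclic_norm (F * G) = cyclic_norm F * cyclic_norm G"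
  by (simp add: cyclic_norm_def rot_mult)

lemma cyclic_norm_1: "cyclic_norm 1 = 1"
  by (simp add: cyclic_norm_def rot_1)

lemma cyclic_norm_power: "cyclic_norm (F ^ n) = cyclic_norm F ^ n"
  by (induction n) (auto simp: cyclic_norm_1 cyclic_norm_mult)

lemma tendsto_cyclic_norm: "(f \<longlongrightarrow> F) \<F> \<Longrightarrow> ((\<lambda>x. cyclic_norm (f x)) \<longlongrightarrow> cyclic_norm F) \<F>"
  unfolding cyclic_norm_def by (intro tendsto_mult_fps tendsto_rot)

lemma diff_cubes_factorization:
  fixes a b w :: "'a::comm_ring_1"
  assumes "w\<^sup>2 + w + 1 = 0"
  shows "(a - b) * (a - w * b) * (a - w * (w * b)) = a ^ 3 - b ^ 3"
proof -
  have w: "w + w * w = - 1"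
    using assms by (simp add: power2_eq_square eq_neg_iff_add_eq_0 add_ac)
  note w3 = cube_eq_1[OF assms]
  have "(a - w * b) * (a - w * (w * b)) = a * a - (w + w * w) * (a * b) + (w * (w * w)) * (b * b)"
    by (simp add: algebra_simps)
  also have "\<dots> = a * a + a * b + b * b" unfolding w w3 by simp
  finally have "(a - b) * ((a - w * b) * (a - w * (w * b))) = a ^ 3 - b ^ 3"
    by (simp add: algebra_simps power3_eq_cube)
  then show ?thesis by (simp add: mult.assoc)
qed

lemma fps_omega_eq: "(fps_const omega)\<^sup>2 + fps_const omega + 1 = (0 :: complex fps)"
proof -
  have "(fps_const omega)\<^sup>2 + fps_const omega + 1 = fps_const (omega\<^sup>2 + omega + 1)"
    by (simp flip: fps_const_1_eq_1)
  then show ?thesis by (simp add: omega_eq)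
qed

lemma cyclic_norm_invariant:
  assumes "rot A = A" "rot B = B"
  shows "cyclic_norm (A - fps_X * B) = A ^ 3 - fps_X ^ 3 * B ^ 3"
proof -
  have "rot (fps_const omega) = fps_const omega"
    using rot_const_mult[of omega 1] by (simp add: rot_1)
  then have "cyclic_norm (A - fps_X * B) = (A - fps_X * B) * (A - fps_const omega * (fps_X * B))
      * (A - fps_const omega * (fps_const omega * (fps_X * B)))"
    by (simp add: cyclic_norm_def rot_diff rot_mult rot_X assms mult.assoc)
  also have "\<dots> = A ^ 3 - (fps_X * B) ^ 3"
    by (intro diff_cubes_factorization fps_omega_eq)
  finally show ?thesis by (simp add: power_mult_distrib)
qed

text \<open>
The conjugates of \<open>1 - q^n\<close> are \<open>1 - \<omega>^(k n) q^n\<close> for \<open>k = 0, 1, 2\<close>. If 3 does not divide \<open>n\<close>, then \<open>k n\<close> runs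
through all residues modulo 3; otherwise the three conjugates coincide.
\<close>
lemma cyclic_norm_binomial:
  "cyclic_norm (1 - fps_X ^ (3 * N)) = (1 - fps_X ^ (3 * N)) ^ 3"
  "cyclic_norm (1 - fps_X ^ (3 * N + 1)) = 1 - fps_X ^ (3 * (3 * N + 1))"
  "cyclic_norm (1 - fps_X ^ (3 * N + 2)) = 1 - fps_X ^ (3 * (3 * N + 2))"
proof -
  define w :: "complex fps" where "w = fps_const omega"
  define x :: "complex fps" where "x = fps_X"
  have rot_w: "rot (w * F) = w * rot F" for F by (simp add: w_def rot_const_mult)
  have w: "w\<^sup>2 + w + 1 = 0" unfolding w_def by (rule fps_omega_eq)
  have pow: "fps_const (omega ^ (3 * N)) = 1" "fps_const (omega ^ (3 * N + 1)) = w"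
     "fps_const (omega ^ (3 * N + 2)) = w * w"
    by (simp_all add: power_add power_mult omega_cubed w_def power2_eq_square)
  have r: "rot (x ^ (3 * N)) = x ^ (3 * N)" "rot (x ^ (3 * N + 1)) = w * x ^ (3 * N + 1)"
     "rot (x ^ (3 * N + 2)) = w * w * x ^ (3 * N + 2)"
    unfolding x_def rot_X_power pow by simp_all
  show "cyclic_norm (1 - fps_X ^ (3 * N)) = (1 - fps_X ^ (3 * N)) ^ 3"
    unfolding cyclic_norm_def x_def[symmetric] rot_diff rot_1 r power3_eq_cube ..
  show "cyclic_norm (1 - fps_X ^ (3 * N + 1)) = 1 - fps_X ^ (3 * (3 * N + 1))"
    unfolding cyclic_norm_def x_def[symmetric] rot_diff rot_1 r rot_w diff_cubes_factorization[OF w]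
    by (simp only: power_one mult.commute[of 3] power_mult)
  (* For exponents 2 modulo 3 the second and the third conjugate change places. *)
  have w4: "w * w * (w * w * F) = w * F" for F
  proof -
    have "w * w * (w * w * F) = w * (w * w) * (w * F)" by (simp only: mult_ac)
    then show ?thesis by (simp add: cube_eq_1[OF w])
  qed
  have "(1 - x ^ (3 * N + 2)) * (1 - w * w * x ^ (3 * N + 2)) * (1 - w * x ^ (3 * N + 2))
      = (1 - x ^ (3 * N + 2)) * (1 - w * x ^ (3 * N + 2)) * (1 - w * (w * x ^ (3 * N + 2)))"
    by (simp only: mult_ac)
  also have "\<dots> = 1 - x ^ (3 * (3 * N + 2))"
    unfolding diff_cubes_factorization[OF w] by (simp only: power_one mult.commute[of 3] power_mult)
  finally show "cyclic_norm (1 - fps_X ^ (3 * N + 2)) = 1 - fps_X ^ (3 * (3 * N + 2))"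
    unfolding cyclic_norm_def x_def[symmetric] rot_diff rot_1 r
    by (simp only: mult.assoc rot_w r) (simp only: mult.assoc[symmetric] w4[unfolded mult.assoc[symmetric]])
qed

text \<open>
The norm of \<open>E_1\<close> is the product of \<open>1 - q^(3 n)\<close> over \<open>n\<close> not divisible by 3, which is
\<open>E_3 / E_9\<close>, times the cube of \<open>E_3\<close>.
\<close>
theorem cyclic_norm_euler: "euler 9 * cyclic_norm (euler 1) = euler 3 ^ 4"
proof (rule tendsto_unique[OF sequentially_bot])
  have fin: "euler_fin 9 N * cyclic_norm (euler_fin 1 (3 * N)) = euler_fin 3 (3 * N) * euler_fin 3 N ^ 3" for N
  proof (induction N)
    case 0
    then show ?case by (simp add: euler_fin_def cyclic_norm_1)
  next
    case (Suc N)
    have 3: "3 * Suc N = Suc (Suc (Suc (3 * N)))" by simp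
    have e1: "euler_fin 1 (3 * Suc N) = euler_fin 1 (3 * N) * (1 - fps_X ^ (3 * N + 1)) *
        (1 - fps_X ^ (3 * N + 2)) * (1 - fps_X ^ (3 * Suc N) :: complex fps)"
      by (simp only: euler_fin_def 3) (simp add: eval_nat_numeral)
    have e3: "euler_fin 3 (3 * Suc N) = euler_fin 3 (3 * N) * (1 - fps_X ^ (3 * (3 * N + 1))) *
        (1 - fps_X ^ (3 * (3 * N + 2))) * (1 - fps_X ^ (9 * Suc N) :: complex fps)"
      unfolding 3 euler_fin_def by (simp add: prod.atLeast_Suc_atMost)
    have e3': "euler_fin 3 (Suc N) = euler_fin 3 N * (1 - fps_X ^ (3 * Suc N) :: complex fps)"
      and e9: "euler_fin 9 (Suc N) = euler_fin 9 N * (1 - fps_X ^ (9 * Suc N) :: complex fps)"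
      by (simp_all add: euler_fin_def)
    have "euler_fin 9 (Suc N) * cyclic_norm (euler_fin 1 (3 * Suc N))
        = (euler_fin 9 N * cyclic_norm (euler_fin 1 (3 * N))) * (1 - fps_X ^ (9 * Suc N))
          * (1 - fps_X ^ (3 * (3 * N + 1))) * (1 - fps_X ^ (3 * (3 * N + 2))) * (1 - fps_X ^ (3 * Suc N)) ^ 3"
      unfolding e1 e9 cyclic_norm_mult cyclic_norm_binomial by (simp only: mult_ac)
    also have "\<dots> = euler_fin 3 (3 * Suc N) * euler_fin 3 (Suc N) ^ 3"
      unfolding Suc.IH e3 e3' power_mult_distrib by (simp only: mult_ac)
    finally show ?case .
  qed
  have lim: "(\<lambda>N. euler_fin d (3 * N)) \<longlonglongrightarrow> (euler d :: complex fps)" if "1 \<le> d" for d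
    using that by (intro filterlim_compose[OF euler_fin_tendsto subseq_3])
  show "(\<lambda>N. euler_fin 9 N * cyclic_norm (euler_fin 1 (3 * N))) \<longlonglongrightarrow> euler 9 * cyclic_norm (euler 1)"
    by (intro tendsto_mult_fps tendsto_cyclic_norm lim euler_fin_tendsto) auto
  have "(\<lambda>N. euler_fin 3 (3 * N) * euler_fin 3 N ^ 3) \<longlonglongrightarrow> (euler 3 * euler 3 ^ 3 :: complex fps)"
    by (intro tendsto_mult_fps tendsto_power_fps lim euler_fin_tendsto) auto
  then show "(\<lambda>N. euler_fin 9 N * cyclic_norm (euler_fin 1 (3 * N))) \<longlonglongrightarrow> euler 3 ^ 4"
    unfolding fin by (simp add: power_Suc[symmetric] del: power_Suc)
qed

lemma fps_compose_X_power_inject: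
  assumes "F oo fps_X ^ d = G oo fps_X ^ d" "1 \<le> d"
  shows "F = (G :: 'a::comm_ring_1 fps)"
proof (rule fps_ext)
  fix n
  have "(F oo fps_X ^ d) $ (d * n) = (G oo fps_X ^ d) $ (d * n)" using assms by simp
  then show "F $ n = G $ n" using assms(2) by (simp add: fps_nth_compose_X_power)
qed

text \<open>
Both sides are compared after substituting \<open>q^3\<close> for \<open>q\<close>: the norm of the trisected cube \<open>A - q B\<close>, with \<open>A\<close> and \<open>B\<close>
series in \<open>q^3\<close>, is \<open>A^3 - q^3 B^3\<close>, and by multiplicativity it is also the cube of the norm of \<open>E_1\<close>.
\<close>
theorem euler_cubic_relation:
  "euler 1 ^ 12 = euler 3 ^ 3 * pent_weighted ^ 3 - 27 * fps_X * euler 3 ^ 12"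
proof (rule fps_compose_X_power_inject)
  define A B where "A = pent_weighted oo fps_X ^ 3" and "B = (3 * euler 9 ^ 3 :: complex fps)"
  have z: "(fps_X ^ 3 :: complex fps) $ 0 = 0" by simp
  have c3: "(euler 1 oo fps_X ^ 3) = (euler 3 :: complex fps)"
    and c9: "(euler 3 oo fps_X ^ 3) = (euler 9 :: complex fps)"
    using euler_compose[of 1 3] euler_compose[of 3 3] by simp_all
  have num: "numeral k oo fps_X ^ 3 = (numeral k :: complex fps)" for k
    by (simp add: numeral_fps_const)
  have rB: "rot B = B"
  proof -
    have "B = (3 * euler 3 ^ 3) oo fps_X ^ 3"
      by (simp add: B_def fps_compose_mult_distrib[OF z] fps_compose_power[OF z, symmetric] num c9)
    then show ?thesis by (simp add: rot_compose)
  qed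
  have rA: "rot A = A" by (simp add: A_def rot_compose)
  have "euler 1 ^ 3 = A - fps_X * B"
    using euler_cubed_trisect by (simp add: A_def B_def mult_ac)
  then have "cyclic_norm (euler 1) ^ 3 = A ^ 3 - fps_X ^ 3 * B ^ 3"
    using cyclic_norm_invariant[OF rA rB] by (simp flip: cyclic_norm_power)
  moreover have "(euler 9 * cyclic_norm (euler 1)) ^ 3 = (euler 3 ^ 4) ^ 3"
    by (simp only: cyclic_norm_euler)
  ultimately have "euler 3 ^ 12 = euler 9 ^ 3 * (A ^ 3 - fps_X ^ 3 * B ^ 3)"
    by (simp add: power_mult_distrib)
  also have "\<dots> = euler 9 ^ 3 * A ^ 3 - 27 * fps_X ^ 3 * euler 9 ^ 12"
    by (simp add: B_def power_mult_distrib algebra_simps flip: power_add power_mult)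
  finally have "euler 3 ^ 12 = euler 9 ^ 3 * A ^ 3 - 27 * fps_X ^ 3 * euler 9 ^ 12" .
  moreover have "(euler 1 ^ 12 oo fps_X ^ 3) = (euler 3 ^ 12 :: complex fps)"
    unfolding fps_compose_power[OF z, symmetric] c3 ..
  moreover have "(euler 3 ^ 3 * pent_weighted ^ 3 - 27 * fps_X * euler 3 ^ 12) oo fps_X ^ 3
     = euler 9 ^ 3 * A ^ 3 - 27 * fps_X ^ 3 * euler 9 ^ 12"
    by (simp add: fps_compose_sub_distrib fps_compose_mult_distrib[OF z]
        fps_compose_power[OF z, symmetric] num c9 A_def fps_X_fps_compose_startby0)
  ultimately show "(euler 1 ^ 12) oo fps_X ^ 3
     = (euler 3 ^ 3 * pent_weighted ^ 3 - 27 * fps_X * euler 3 ^ 12) oo fps_X ^ 3"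
    by simp
qed simp

section \<open>The tenth power of the Euler product\<close>

lemma qderiv_compose: "qderiv (F oo fps_X ^ 3) = 3 * (qderiv F oo fps_X ^ 3)"
  by (auto simp: fps_eq_iff fps_nth_compose_X_power numeral_fps_const elim!: dvdE)

text \<open>
Applying \<open>D\<close> to the cubic relation gives a linear equation for \<open>D P\<close> with coefficients in \<open>E_1\<close>,
\<open>E_3\<close>, \<open>P\<close>, \<open>S\<close>, \<open>S(q^3)\<close> and \<open>q\<close>. The cubic relation removes \<open>q\<close>, and then \<open>S\<close> and \<open>S(q^3)\<close> appear in the
combination \<open>1 + 12 S - 36 S(q^3) = P^2 / E_1^2\<close>, which lowers \<open>E_1^12\<close> to \<open>E_1^10 P^2\<close>.
\<close>
theorem euler_tenth_power:
  "euler 1 ^ 10 = euler 3 ^ 3 * pent_weighted + 3 * (qderiv (euler 3 ^ 3) * pent_weighted - euler 3 ^ 3 * qderiv pent_weighted)"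
proof -
  define E F s s3 DP where "E = (euler 1 :: complex fps)" and "F = (euler 3 :: complex fps)"
    and "s = sigma_fps" and "s3 = sigma_fps oo fps_X ^ 3" and "DP = qderiv pent_weighted"
  have z: "(fps_X ^ 3 :: complex fps) $ 0 = 0" by simp
  have F: "F = E oo fps_X ^ 3" using euler_compose[of 1 3, where ?'a = complex] by (simp add: F_def E_def)
  have DE: "qderiv E = - E * s" using qderiv_euler by (simp add: E_def s_def)
  have DF: "qderiv F = - 3 * F * s3"
    unfolding F qderiv_compose DE s_def s3_def
    by (simp add: fps_compose_mult_distrib[OF z] fps_compose_uminus)
  have DX: "qderiv fps_X = fps_X" by (simp add: qderiv_def)
  have rel1: "pent_weighted\<^sup>2 = E\<^sup>2 * (1 + 12 * s - 36 * s3)"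
    using pent_weighted_squared by (simp add: E_def s_def s3_def)
  have rel2: "E ^ 12 = F ^ 3 * pent_weighted ^ 3 - 27 * fps_X * F ^ 12"
    using euler_cubic_relation by (simp add: E_def F_def)
  have "qderiv (E ^ 12) = qderiv (F ^ 3 * pent_weighted ^ 3 - 27 * fps_X * F ^ 12)"
    by (simp only: rel2)
  moreover have "qderiv 27 = 0" by (simp add: qderiv_def)
  ultimately have D2: "12 * E ^ 11 * (- E * s) = F ^ 3 * (3 * pent_weighted\<^sup>2 * DP) + 3 * F\<^sup>2 * (- 3 * F * s3) * pent_weighted ^ 3
     - 27 * (fps_X * (12 * F ^ 11 * (- 3 * F * s3)) + fps_X * F ^ 12)"
    by (simp add: qderiv_diff qderiv_mult qderiv_power DE DF DX DP_def algebra_simps)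
  have "pent_weighted\<^sup>2 * E ^ 10 = pent_weighted\<^sup>2 * (F ^ 3 * pent_weighted + 3 * (3 * F\<^sup>2 * (- 3 * F * s3) * pent_weighted - F ^ 3 * DP))"
  proof -
    have X: "27 * fps_X * F ^ 12 = F ^ 3 * pent_weighted ^ 3 - E ^ 12" using rel2 by simp
    have "3 * (F ^ 3 * pent_weighted\<^sup>2 * DP)
        = - 12 * (E ^ 12 * s) + 9 * (F ^ 3 * s3 * pent_weighted ^ 3) + (27 * fps_X * F ^ 12) * (1 - 36 * s3)"
      using D2 by (simp add: algebra_simps eval_nat_numeral)
    then have D: "3 * (F ^ 3 * pent_weighted\<^sup>2 * DP)
        = - 12 * (E ^ 12 * s) + 9 * (F ^ 3 * s3 * pent_weighted ^ 3) + (F ^ 3 * pent_weighted ^ 3 - E ^ 12) * (1 - 36 * s3)"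
      unfolding X .
    have "pent_weighted\<^sup>2 * (F ^ 3 * pent_weighted + 3 * (3 * F\<^sup>2 * (- 3 * F * s3) * pent_weighted - F ^ 3 * DP))
        = F ^ 3 * pent_weighted ^ 3 - 27 * (F ^ 3 * s3 * pent_weighted ^ 3) - 3 * (F ^ 3 * pent_weighted\<^sup>2 * DP)"
      by (simp add: algebra_simps eval_nat_numeral)
    also have "\<dots> = E ^ 10 * (E\<^sup>2 * (1 + 12 * s - 36 * s3))"
      unfolding D by (simp add: algebra_simps flip: power_add)
    also have "\<dots> = pent_weighted\<^sup>2 * E ^ 10"
      unfolding rel1 by simp
    finally show ?thesis ..
  qed
  moreover have "pent_weighted\<^sup>2 \<noteq> 0"
  proof -
    have "pent_weighted\<^sup>2 $ 0 = 1"
      using rel1 euler_nth_0[of 1, where ?'a = complex]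
      by (simp add: s_def s3_def sigma_fps_def E_def fps_power_zeroth)
    then show ?thesis by (metis fps_zero_nth zero_neq_one)
  qed
  ultimately have "E ^ 10 = F ^ 3 * pent_weighted + 3 * (3 * F\<^sup>2 * (- 3 * F * s3) * pent_weighted - F ^ 3 * DP)"
    by simp
  then show ?thesis
    unfolding E_def[symmetric] F_def[symmetric] DP_def[symmetric] qderiv_power DF by simp
qed

lemma theta_mult_support:
  assumes "(theta c e * theta c' e' :: complex fps) $ M \<noteq> 0"
  shows "\<exists>n m. M = e n + e' m"
proof -
  obtain i where i: "i \<le> M" "theta c e $ i \<noteq> 0" "theta c' e' $ (M - i) \<noteq> 0"
    using assms unfolding fps_mult_nth by (metis (no_types, lifting) atLeastAtMost_iff mult_not_zero sum.not_neutral_contains_not_neutral)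
  have fibre: "\<exists>n. e n = k" if "theta c e $ k \<noteq> 0" for c :: "int \<Rightarrow> complex" and e k
    using that by (cases "{n. e n = k} = {}") (auto simp: theta_def)
  obtain n m where "e n = i" "e' m = M - i" using fibre[OF i(2)] fibre[OF i(3)] by blast
  then show ?thesis using i(1) by (intro exI[of _ n] exI[of _ m]) simp
qed

text \<open>
All three products in \<open>euler_tenth_power\<close> are products of a theta series in the exponents
\<open>3 n (n + 1)/2\<close> with one in the exponents \<open>m (3 m + 1)/2\<close>. Completing the squares gives
\<open>x = 3 (2 n + 1)\<close> and \<open>y = 6 m + 1\<close>.
\<close>
theorem euler_tenth_power_support:
  assumes "(euler 1 ^ 10 :: complex fps) $ M \<noteq> 0"
  shows "\<exists>x y :: int. 24 * int M + 10 = x\<^sup>2 + y\<^sup>2"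
proof -
  define c where "c = (\<lambda>n. alt_sign n * of_int n :: complex)"
  have F3: "(euler 3 :: complex fps) ^ 3 = theta c (\<lambda>n. 3 * tri n)"
  proof -
    have "euler 1 oo fps_X ^ 3 = (euler 3 :: complex fps)" using euler_compose[of 1 3] by simp
    then have "(euler 3 :: complex fps) ^ 3 = (euler 1 ^ 3) oo fps_X ^ 3"
      by (simp add: fps_compose_power[symmetric])
    then show ?thesis unfolding jacobi_euler_cubed by (simp add: theta_compose c_def)
  qed
  have "(euler 3 ^ 3 * pent_weighted) $ M \<noteq> 0 \<or> (qderiv (euler 3 ^ 3) * pent_weighted) $ M \<noteq> 0
      \<or> (euler 3 ^ 3 * qderiv pent_weighted) $ M \<noteq> 0"
    using assms unfolding euler_tenth_power by (auto simp: numeral_fps_const)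
  then have "\<exists>n m. M = 3 * tri n + pent m"
    unfolding F3 pent_weighted_def qderiv_theta by (elim disjE) (erule theta_mult_support)+
  then obtain n m where M: "M = 3 * tri n + pent m" by blast
  have "24 * int M + 10 = (3 * (2 * n + 1))\<^sup>2 + (6 * m + 1)\<^sup>2"
    using int_tri[of n] int_pent[of m] by (simp add: M power2_eq_square algebra_simps)
  then show ?thesis by blast
qed

section \<open>Regular partitions modulo a prime\<close>

text \<open>
Congruences live in the integers, while the identity for the tenth power is proved over the complex
numbers, where \<open>\<omega>\<close> exists. This ring homomorphism connects the two.
\<close>
definition fps_of_ints :: "int fps \<Rightarrow> complex fps" where
  "fps_of_ints F = Abs_fps (\<lambda>n. of_int (F $ n))"

lemma fps_of_ints_mult: "fps_of_ints (F * G) = fps_of_ints F * fps_of_ints G"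
  by (simp add: fps_eq_iff fps_of_ints_def fps_mult_nth)

lemma fps_of_ints_1: "fps_of_ints 1 = 1"
  by (simp add: fps_eq_iff fps_of_ints_def)

lemma fps_of_ints_power: "fps_of_ints (F ^ n) = fps_of_ints F ^ n"
  by (induction n) (simp_all add: fps_of_ints_1 fps_of_ints_mult)

lemma fps_of_ints_euler: "fps_of_ints (euler d) = euler d"
proof -
  have "fps_of_ints (euler_fin d N) = euler_fin d N" for N
  proof (induction N)
    case (Suc N)
    have "fps_of_ints (1 - fps_X ^ (d * Suc N)) = 1 - fps_X ^ (d * Suc N)"
      by (auto simp: fps_eq_iff fps_of_ints_def simp del: mult_Suc_right)
    then show ?case using Suc by (simp add: euler_fin_def fps_of_ints_mult)
  qed (simp add: euler_fin_def fps_of_ints_1)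
  then show ?thesis by (auto simp: fps_eq_iff fps_of_ints_def euler_def)
qed

definition partitions_in :: "nat set \<Rightarrow> nat \<Rightarrow> nat multiset set" where
  "partitions_in A n = {M. sum_mset M = n \<and> set_mset M \<subseteq> A}"

lemma finite_partitions_in: "0 \<notin> A \<Longrightarrow> finite (partitions_in A n)"
  by (rule finite_subset[OF _ finite_regular_partitions[of 0 n]])
     (auto simp: partitions_in_def regular_partitions_def intro: gr0I)

definition partition_fps :: "nat set \<Rightarrow> int fps" where
  "partition_fps A = Abs_fps (\<lambda>n. int (card (partitions_in A n)))"

text \<open>
A partition with parts in \<open>insert a A\<close> either has no part \<open>a\<close> or arises from a unique partition of
\<open>n - a\<close> by adding a part \<open>a\<close>.
\<close>
lemma partition_fps_insert:
  assumes "0 \<notin> A" "a \<notin> A" "0 < a"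
  shows "(1 - fps_X ^ a) * partition_fps (insert a A) = partition_fps A"
proof (rule fps_ext)
  fix n
  define Q where "Q = (if n < a then {} else add_mset a ` partitions_in (insert a A) (n - a))"
  have "partitions_in (insert a A) n = partitions_in A n \<union> Q"
  proof (intro equalityI subsetI)
    fix M assume M: "M \<in> partitions_in (insert a A) n"
    show "M \<in> partitions_in A n \<union> Q"
    proof (cases "a \<in># M")
      case True
      then obtain M' where "M = add_mset a M'" by (metis insert_DiffM)
      then show ?thesis using M by (auto simp: partitions_in_def Q_def)
    next
      case False
      then show ?thesis using M by (auto simp: partitions_in_def)
    qed
  qed (auto simp: partitions_in_def Q_def not_less split: if_splits)
  moreover have "partitions_in A n \<inter> Q = {}"
  proof -
    have "a \<notin># M" if "M \<in> partitions_in A n" for M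
      using that assms(2) by (auto simp: partitions_in_def)
    moreover have "a \<in># M" if "M \<in> Q" for M
      using that by (cases "n < a") (auto simp: Q_def)
    ultimately show ?thesis by blast
  qed
  moreover have "finite (partitions_in A n)" "finite Q"
    using assms by (auto simp: Q_def intro!: finite_partitions_in)
  ultimately have "card (partitions_in (insert a A) n) = card (partitions_in A n) + card Q"
    by (simp add: card_Un_disjoint)
  moreover have "card Q = (if n < a then 0 else card (partitions_in (insert a A) (n - a)))"
    by (auto simp: Q_def intro!: card_image inj_onI)
  ultimately show "((1 - fps_X ^ a) * partition_fps (insert a A)) $ n = partition_fps A $ n"
    by (simp add: one_minus_X_power_mult_nth partition_fps_def)
qed

lemma partition_fps_prod:
  assumes "finite A" "0 \<notin> A"
  shows "(\<Prod>a\<in>A. 1 - fps_X ^ a) * partition_fps A = 1"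
  using assms
proof (induction A rule: finite_induct)
  case empty
  have "partitions_in {} n = (if n = 0 then {{#}} else {})" for n
    by (auto simp: partitions_in_def)
  then show ?case by (simp add: partition_fps_def fps_eq_iff)
next
  case (insert a A)
  then have IH: "(\<Prod>a\<in>A. 1 - fps_X ^ a) * partition_fps A = 1"
    and step: "(1 - fps_X ^ a) * partition_fps (insert a A) = partition_fps A"
    by (auto intro: partition_fps_insert)
  have "(\<Prod>a\<in>insert a A. 1 - fps_X ^ a) * partition_fps (insert a A)
      = (\<Prod>a\<in>A. 1 - fps_X ^ a) * ((1 - fps_X ^ a) * partition_fps (insert a A))"
    unfolding prod.insert[OF insert.hyps(1,2)] by (simp only: mult_ac)
  then show ?case by (simp only: step IH)
qed

definition regular_fps :: "nat \<Rightarrow> int fps" where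
  "regular_fps l = Abs_fps (\<lambda>n. int (card (regular_partitions l n)))"

text \<open>
For the coefficient of \<open>q^n\<close> only the parts up to \<open>l N\<close> matter as soon as \<open>n \<le> l N\<close>. The finite product over
\<open>{1..l N}\<close> splits into the allowed parts, which cancel the partitions, and the multiples of \<open>l\<close>.
\<close>
theorem regular_fps_euler:
  assumes l: "1 \<le> l"
  shows "regular_fps l * euler 1 = euler l"
proof (rule tendsto_unique[OF sequentially_bot])
  define A where "A N = {i \<in> {1..l * N}. \<not> l dvd i}" for N
  have A: "finite (A N)" "0 \<notin> A N" for N by (auto simp: A_def)
  have fin: "partition_fps (A N) * euler_fin 1 (l * N) = euler_fin l N" for N
  proof -
    have "euler_fin 1 (l * N) = (\<Prod>i\<in>{1..l * N}. 1 - fps_X ^ i :: int fps)"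
      by (simp add: euler_fin_def)
    also have "{1..l * N} = A N \<union> (\<lambda>i. l * i) ` {1..N}"
    proof (intro equalityI subsetI)
      fix i assume i: "i \<in> {1..l * N}"
      show "i \<in> A N \<union> (\<lambda>i. l * i) ` {1..N}"
      proof (cases "l dvd i")
        case True
        then obtain k where "i = l * k" ..
        then show ?thesis using i l by (auto simp: Suc_le_eq)
      next
        case False
        then show ?thesis using i by (simp add: A_def)
      qed
    qed (use l in \<open>auto simp: A_def\<close>)
    also have "(\<Prod>i\<in>A N \<union> (\<lambda>i. l * i) ` {1..N}. 1 - fps_X ^ i :: int fps)
       = (\<Prod>i\<in>A N. 1 - fps_X ^ i) * (\<Prod>i\<in>(\<lambda>i. l * i) ` {1..N}. 1 - fps_X ^ i)"
      using A by (intro prod.union_disjoint) (auto simp: A_def)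
    also have "(\<Prod>i\<in>(\<lambda>i. l * i) ` {1..N}. 1 - fps_X ^ i) = (euler_fin l N :: int fps)"
      using l by (subst prod.reindex) (auto simp: inj_on_def euler_fin_def)
    finally have "partition_fps (A N) * euler_fin 1 (l * N)
        = ((\<Prod>i\<in>A N. 1 - fps_X ^ i) * partition_fps (A N)) * euler_fin l N"
      by (simp only: mult_ac)
    then show ?thesis by (simp only: partition_fps_prod[OF A] mult_1)
  qed
  have "(\<lambda>N. partition_fps (A N)) \<longlonglongrightarrow> regular_fps l"
  proof (rule tendsto_fpsI)
    fix n
    show "eventually (\<lambda>N. partition_fps (A N) $ n = regular_fps l $ n) sequentially"
      using eventually_ge_at_top[of n]
    proof eventually_elim
      case (elim N)
      have "n \<le> l * N" using elim l by (metis le_trans mult_le_mono1 nat_mult_1)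
      then have "x \<le> l * N" if "x \<in># M" "sum_mset M = n" for x M
        using that by (metis insert_DiffM le_add1 le_trans sum_mset.add_mset)
      then have "partitions_in (A N) n = regular_partitions l n"
        by (auto simp: partitions_in_def regular_partitions_def A_def Suc_le_eq)
      then show ?case by (simp add: partition_fps_def regular_fps_def)
    qed
  qed
  moreover have "filterlim (\<lambda>N. l * N) at_top sequentially"
    using l by (intro filterlim_subseq) (auto simp: strict_mono_def)
  then have "(\<lambda>N. euler_fin 1 (l * N)) \<longlonglongrightarrow> (euler 1 :: int fps)"
    by (intro filterlim_compose[OF euler_fin_tendsto]) auto
  ultimately have "(\<lambda>N. partition_fps (A N) * euler_fin 1 (l * N)) \<longlonglongrightarrow> regular_fps l * euler 1"
    by (rule tendsto_mult_fps)
  then show "euler_fin l \<longlonglongrightarrow> regular_fps l * euler 1"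
    by (simp only: fin)
  show "euler_fin l \<longlonglongrightarrow> (euler l :: int fps)" using l by (rule euler_fin_tendsto)
qed

text \<open>
The inner binomial coefficients are divisible by \<open>p\<close>. Oddness fixes the sign of \<open>(- Y) ^ p\<close>.
\<close>
lemma one_minus_power_prime_cong:
  fixes Y :: "'a::comm_ring_1"
  assumes "prime p" "odd p"
  shows "of_nat p dvd (1 - Y) ^ p - (1 - Y ^ p)"
proof -
  have p: "1 < p" using assms(1) by (rule prime_gt_1_nat)
  have "(1 - Y) ^ p = (- Y + 1) ^ p" by simp
  also have "\<dots> = (\<Sum>k\<le>p. of_nat (p choose k) * (- Y) ^ k)"
    unfolding binomial_ring by simp
  also have "{..p} = insert 0 (insert p {0<..<p})" using p by auto
  also have "(\<Sum>k\<in>\<dots>. of_nat (p choose k) * (- Y) ^ k)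
      = 1 - Y ^ p + (\<Sum>k\<in>{0<..<p}. of_nat (p choose k) * (- Y) ^ k)"
    using p assms(2) by simp
  finally have "(1 - Y) ^ p - (1 - Y ^ p) = (\<Sum>k\<in>{0<..<p}. of_nat (p choose k) * (- Y) ^ k)"
    by simp
  also have "of_nat p dvd \<dots>"
  proof (intro dvd_sum dvd_mult2)
    fix k assume "k \<in> {0<..<p}"
    then have "p dvd (p choose k)" using assms(1) by (intro dvd_choose_prime) auto
    then show "of_nat p dvd (of_nat (p choose k) :: 'a)" by (auto elim!: dvdE)
  qed
  finally show ?thesis .
qed

lemma euler_power_prime_cong:
  assumes "prime p" "odd p"
  shows "int p dvd (euler 1 ^ p - euler p) $ n"
proof -
  have fin: "of_nat p dvd (euler_fin 1 N ^ p - euler_fin p N :: int fps)" for N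
  proof (induction N)
    case (Suc N)
    define u :: "int fps" where "u = euler_fin 1 N"
    define v :: "int fps" where "v = 1 - fps_X ^ Suc N"
    define v' :: "int fps" where "v' = 1 - (fps_X ^ Suc N) ^ p"
    have "euler_fin 1 (Suc N) = u * v" by (simp add: euler_fin_def u_def v_def)
    moreover have "euler_fin p (Suc N) = euler_fin p N * v'"
      by (simp add: euler_fin_def v'_def mult.commute del: power_Suc flip: power_mult)
    ultimately have "euler_fin 1 (Suc N) ^ p - euler_fin p (Suc N)
        = (u ^ p - euler_fin p N) * v ^ p + euler_fin p N * (v ^ p - v')"
      by (simp add: power_mult_distrib algebra_simps)
    moreover have "of_nat p dvd v ^ p - v'"
      unfolding v_def v'_def by (rule one_minus_power_prime_cong[OF assms])
    ultimately show ?case using Suc.IH by (simp add: u_def)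
  qed (simp add: euler_fin_def)
  have "1 \<le> p" using assms(1) by (rule prime_ge_1_nat)
  then have "(\<lambda>N. euler_fin 1 N ^ p - euler_fin p N) \<longlonglongrightarrow> (euler 1 ^ p - euler p :: int fps)"
    by (intro tendsto_diff_fps tendsto_power_fps euler_fin_tendsto) auto
  then have "eventually (\<lambda>N. (euler_fin 1 N ^ p - euler_fin p N) $ n
      = (euler 1 ^ p - euler p :: int fps) $ n) sequentially"
    unfolding tendsto_fps_iff by blast
  then obtain N where "(euler_fin 1 N ^ p - euler_fin p N) $ n = (euler 1 ^ p - euler p :: int fps) $ n"
    using eventually_happens'[OF sequentially_bot] by blast
  moreover obtain G :: "int fps" where "euler_fin 1 N ^ p - euler_fin p N = of_nat p * G"
    using fin by (metis dvdE)
  ultimately show ?thesis by (metis dvd_triv_left fps_mult_of_nat_nth(1))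
qed

text \<open>
A series with constant term 1 is a unit, so it can be cancelled modulo \<open>p\<close>.
\<close>
lemma dvd_nth_cancel:
  fixes U H :: "int fps"
  assumes "U $ 0 = 1" "\<And>n. p dvd (U * H) $ n"
  shows "p dvd H $ n"
proof (induction n rule: less_induct)
  case (less n)
  have "(U * H) $ n = H $ n + (\<Sum>i=Suc 0..n. U $ i * H $ (n - i))"
    using assms(1) by (simp add: fps_mult_nth sum.atLeast_Suc_atMost)
  moreover have "p dvd (\<Sum>i=Suc 0..n. U $ i * H $ (n - i))"
    by (intro dvd_sum dvd_mult less) auto
  ultimately show ?case using assms(2)[of n] by (metis dvd_add_left_iff)
qed

text \<open>
Modulo \<open>p\<close>, the generating function times \<open>E_1\<close> is \<open>E_p\<close>, that is, \<open>E_1^p\<close>, and one factor \<open>E_1\<close> cancels.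
\<close>
theorem regular_fps_cong:
  assumes "prime p" "odd p"
  shows "[(regular_fps p) $ n = (euler 1 ^ (p - 1)) $ n] (mod int p)"
proof -
  define E :: "int fps" where "E = euler 1"
  have p: "1 \<le> p" using assms(1) by (rule prime_ge_1_nat)
  then have "E ^ p = E * E ^ (p - 1)" by (metis power_minus_mult mult.commute less_le_trans zero_less_one)
  then have "E * (E ^ (p - 1) - regular_fps p) = E ^ p - euler p"
    using regular_fps_euler[OF p] by (simp add: E_def algebra_simps)
  then have "int p dvd (E * (E ^ (p - 1) - regular_fps p)) $ n" for n
    using euler_power_prime_cong[OF assms, of n] by (simp add: E_def)
  moreover have "E $ 0 = 1" by (simp add: E_def euler_nth_0)
  ultimately have "int p dvd (E ^ (p - 1) - regular_fps p) $ n"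
    by (rule dvd_nth_cancel[rotated])
  then show ?thesis
    by (simp add: E_def cong_iff_dvd_diff dvd_diff_commute[of _ "regular_fps p $ n"])
qed

section \<open>Sums of two squares\<close>

text \<open>
Raising \<open>x^2 = - y^2\<close> to the odd power \<open>(p - 1) div 2\<close> turns it into \<open>1 = - 1\<close> modulo \<open>p\<close>, by Fermat's little theorem,
unless \<open>p\<close> divides both \<open>x\<close> and \<open>y\<close>.
\<close>
lemma prime_3_mod_4_dvd_sum_squares:
  fixes x y :: int
  assumes p: "prime p" "[p = 3] (mod 4)" and dvd: "int p dvd x\<^sup>2 + y\<^sup>2"
  shows "int p dvd x"
proof (rule ccontr)
  assume x: "\<not> int p dvd x"
  have prime: "prime (int p)" using p(1) by simp
  have "\<not> int p dvd y"
  proof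
    assume "int p dvd y"
    then have "int p dvd x\<^sup>2" using dvd by (simp add: dvd_add_left_iff power2_eq_square)
    then show False using x prime by (simp add: prime_dvd_power_iff)
  qed
  have fermat: "[z ^ (p - 1) = 1] (mod int p)" if "\<not> int p dvd z" for z :: int
  proof -
    have "\<not> p dvd nat \<bar>z\<bar>" using that by (simp flip: int_dvd_int_iff)
    then have "[nat \<bar>z\<bar> ^ (p - 1) = 1] (mod p)" by (rule fermat_theorem[OF p(1)])
    then have "[int (nat \<bar>z\<bar> ^ (p - 1)) = int 1] (mod int p)" by (simp only: cong_int_iff)
    moreover have "even (p - 1)" using p(2) unfolding cong_def by presburger
    ultimately show ?thesis by (simp add: power_even_abs)
  qed
  obtain k where k: "p - 1 = 2 * (2 * k + 1)"
  proof
    show "p - 1 = 2 * (2 * (p div 4) + 1)" using p(2) unfolding cong_def by presburger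
  qed
  have "[x\<^sup>2 = - (y\<^sup>2)] (mod int p)" using dvd by (simp add: cong_iff_dvd_diff)
  then have "[(x\<^sup>2) ^ (2 * k + 1) = (- (y\<^sup>2)) ^ (2 * k + 1)] (mod int p)" by (rule cong_pow)
  then have "[x ^ (p - 1) = - (y ^ (p - 1))] (mod int p)"
    unfolding k power_mult by simp
  moreover have "[- (y ^ (p - 1)) = - 1] (mod int p)"
    using fermat[OF \<open>\<not> int p dvd y\<close>] by (simp only: cong_minus_minus_iff)
  ultimately have "[1 = - 1] (mod int p)"
    using fermat[OF x] by (meson cong_sym cong_trans)
  then have "int p dvd 2" by (simp add: cong_iff_dvd_diff)
  then have "int p \<le> 2" by (rule zdvd_imp_le) simp
  moreover have "p \<noteq> 2" using p(2) by (auto simp: cong_def)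
  ultimately show False using prime_ge_2_nat[OF p(1)] by simp
qed

text \<open>
Infinite descent: if \<open>p\<close> divides the sum, it divides both \<open>x\<close> and \<open>y\<close>, and dividing them by \<open>p\<close> lowers the multiplicity by 2.
\<close>
lemma even_multiplicity_sum_squares:
  fixes x y :: int
  assumes p: "prime p" "[p = 3] (mod 4)" and nz: "x\<^sup>2 + y\<^sup>2 \<noteq> 0"
  shows "even (multiplicity (int p) (x\<^sup>2 + y\<^sup>2))"
  using nz
proof (induction "nat (\<bar>x\<bar> + \<bar>y\<bar>)" arbitrary: x y rule: less_induct)
  case less
  show ?case
  proof (cases "int p dvd x\<^sup>2 + y\<^sup>2")
    case False
    then show ?thesis by (simp add: not_dvd_imp_multiplicity_0)
  next
    case True
    then have "int p dvd x" "int p dvd y"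
      using prime_3_mod_4_dvd_sum_squares[OF p, of x y] prime_3_mod_4_dvd_sum_squares[OF p, of y x]
      by (simp_all add: add.commute)
    then obtain a b where ab: "x = int p * a" "y = int p * b" by (auto elim!: dvdE)
    have xy: "x\<^sup>2 + y\<^sup>2 = int p ^ 2 * (a\<^sup>2 + b\<^sup>2)" by (simp add: ab algebra_simps)
    then have nz: "a\<^sup>2 + b\<^sup>2 \<noteq> 0" using less.prems by auto
    have "2 \<le> int p" using prime_ge_2_nat[OF p(1)] by simp
    have pos: "0 < \<bar>a\<bar> + \<bar>b\<bar>" using nz by auto
    have "\<bar>a\<bar> + \<bar>b\<bar> < 2 * (\<bar>a\<bar> + \<bar>b\<bar>)" using pos by simp
    also have "\<dots> \<le> int p * (\<bar>a\<bar> + \<bar>b\<bar>)" using \<open>2 \<le> int p\<close> pos by (intro mult_right_mono) auto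
    also have "\<dots> = \<bar>x\<bar> + \<bar>y\<bar>" by (simp add: ab abs_mult algebra_simps)
    finally have "even (multiplicity (int p) (a\<^sup>2 + b\<^sup>2))"
      using less.hyps[of a b] nz by simp
    moreover have "prime_elem (int p)" using p(1) by simp
    ultimately show ?thesis
      using nz unfolding xy
      by (subst prime_elem_multiplicity_mult_distrib)
         (auto simp: prime_elem_multiplicity_power_distrib multiplicity_self)
  qed
qed

section \<open>The congruence for 11-regular partitions\<close>

theorem dvd_b_reg_11:
  assumes p: "prime p" "[p = 3] (mod 4)" and M: "0 \<le> M"
    and odd: "odd (multiplicity (int p) (24 * M + 10))"
  shows "[b_reg 11 M = 0] (mod 11)"
proof -
  obtain m where m: "M = int m" using M by (metis nonneg_int_cases)
  have "(euler 1 ^ 10 :: complex fps) $ m = 0"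
  proof (rule ccontr)
    assume "(euler 1 ^ 10 :: complex fps) $ m \<noteq> 0"
    then obtain x y :: int where xy: "24 * M + 10 = x\<^sup>2 + y\<^sup>2"
      using euler_tenth_power_support m by blast
    moreover have "24 * M + 10 \<noteq> 0" using M by simp
    ultimately show False using even_multiplicity_sum_squares[OF p, of x y] odd by simp
  qed
  moreover have "(euler 1 ^ 10 :: complex fps) $ m = of_int ((euler 1 ^ 10) $ m)"
  proof -
    have "euler 1 ^ 10 = fps_of_ints (euler 1 ^ 10)"
      by (simp only: fps_of_ints_power fps_of_ints_euler)
    then show ?thesis by (simp add: fps_of_ints_def)
  qed
  ultimately have "(euler 1 ^ 10 :: int fps) $ m = 0" by simp
  moreover have "prime (11 :: nat)" by simp
  ultimately have "[regular_fps 11 $ m = 0] (mod int 11)"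
    using regular_fps_cong[of 11 m] by simp
  then have "[int (b_reg 11 M) = int 0] (mod int 11)"
    by (simp add: regular_fps_def b_reg_def m)
  then show ?thesis by (simp only: cong_int_iff)
qed

theorem theorem1p2:
  fixes \<alpha> n :: nat and p :: "nat \<Rightarrow> nat" and j :: int
  assumes "\<And>i. i \<in> {1..\<alpha>+1} \<Longrightarrow> prime (p i)"
    and "\<And>i. i \<in> {1..\<alpha>+1} \<Longrightarrow> p i \<ge> 5"
    and "\<And>i. i \<in> {1..\<alpha>+1} \<Longrightarrow> [p i = 3] (mod 4)"
    and "\<not> [j = 0] (mod int (p (\<alpha>+1)))"
  shows "[b_reg 11 ((\<Prod>i=1..\<alpha>+1. int (p i) ^ 2) * int n
           + ((\<Prod>i=1..\<alpha>. int (p i) ^ 2) * int (p (\<alpha>+1)) * (12 * j + 5 * int (p (\<alpha>+1))) - 5) div 12)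
         = 0] (mod 11)"
proof -
  define q where "q = p (\<alpha> + 1)"
  define R where "R = (\<Prod>i=1..\<alpha>. int (p i))"
  define c where "c = 12 * int q * int n + 12 * j + 5 * int q"
  define M where "M = (\<Prod>i=1..\<alpha>+1. int (p i) ^ 2) * int n
     + ((\<Prod>i=1..\<alpha>. int (p i) ^ 2) * int (p (\<alpha>+1)) * (12 * j + 5 * int (p (\<alpha>+1))) - 5) div 12"
  have q: "prime q" "5 \<le> q" "[q = 3] (mod 4)" using assms by (auto simp: q_def)
  then have prime: "prime_elem (int q)" by simp
  have R2: "(\<Prod>i=1..\<alpha>. int (p i) ^ 2) = R\<^sup>2" by (simp add: R_def prod_power_distrib)
  (* The division by 12 in the argument is exact. *)
  have "12 dvd R\<^sup>2 * int q * (12 * j + 5 * int q) - 5"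
    unfolding q_def R2[symmetric] by (rule argument_integral) (fact assms(1), fact assms(2))
  then have "12 * ((R\<^sup>2 * int q * (12 * j + 5 * int q) - 5) div 12) = R\<^sup>2 * int q * (12 * j + 5 * int q) - 5"
    by simp
  moreover have "(\<Prod>i=1..\<alpha>+1. int (p i) ^ 2) = R\<^sup>2 * (int q)\<^sup>2"
    using R2 by (simp add: q_def)
  then have "M = R\<^sup>2 * (int q)\<^sup>2 * int n + (R\<^sup>2 * int q * (12 * j + 5 * int q) - 5) div 12"
    unfolding M_def R2 q_def[symmetric] by simp
  ultimately have "12 * M + 5 = 12 * (R\<^sup>2 * (int q)\<^sup>2 * int n) + R\<^sup>2 * int q * (12 * j + 5 * int q)"
    by simp
  then have M: "24 * M + 10 = 2 * (R\<^sup>2 * (int q * c))"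
    by (simp add: c_def algebra_simps power2_eq_square)
  have "\<not> int q dvd 12 * j"
  proof
    assume "int q dvd 12 * j"
    moreover have "\<not> int q dvd j" using assms(4) by (simp add: q_def cong_0_iff)
    ultimately have "int q dvd 2 * (2 * 3)" using prime by (auto simp: prime_elem_dvd_mult_iff)
    then have "int q dvd 2 \<or> int q dvd 3" using prime by (metis prime_elem_dvd_mult_iff)
    then show False using q(2) by (auto dest!: zdvd_imp_le)
  qed
  moreover have "c = 12 * j + int q * (12 * int n + 5)" by (simp add: c_def algebra_simps)
  ultimately have c: "\<not> int q dvd c" by (simp add: dvd_add_left_iff)
  have two: "\<not> int q dvd 2" using q(2) by (auto dest!: zdvd_imp_le)
  have "R \<noteq> 0" using assms(2) by (force simp: R_def)
  moreover have "c \<noteq> 0" using c by auto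
  ultimately have "multiplicity (int q) (24 * M + 10) = 2 * multiplicity (int q) R + 1"
    unfolding M using prime c two q(1)
    by (simp add: prime_elem_multiplicity_mult_distrib prime_elem_multiplicity_power_distrib
        not_dvd_imp_multiplicity_0 multiplicity_self)
  then have odd: "odd (multiplicity (int q) (24 * M + 10))" by simp
  show ?thesis
  proof (cases "0 \<le> M")
    case True
    then show ?thesis using dvd_b_reg_11[OF q(1,3) True odd] by (simp add: M_def)
  next
    case False
    (* A negative j can make the argument negative, where b_reg is 0 by convention. *)
    then have "b_reg 11 M = 0" by (simp add: b_reg_def)
    then show ?thesis unfolding M_def by (simp add: cong_def)
  qed
qed

end
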